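(* Let $(\mathbb{L},\mu)$ be a random iterated function system of contracting similarities on $\mathbb{R}^d$ satisfying the uniform open set condition, with $2\le\sup_\lambda\mathcal{N}_\lambda<\infty$ and $\mathbb{E}(\log\mathcal{N}_{\omega_1})>0$, and suppose that for every $\lambda\in\Lambda$ there is $c_\lambda\in[c_{\min},c_{\max}]$ with $c_\lambda^i=c_\lambda$ for every $1\le i\le\mathcal{N}_\lambda$, where $0<c_{\min}\le c_{\max}<1$. Assume $(\mathbb{L},\mu)$ is not almost deterministic. Let $F_\omega$ be the associated random homogeneous attractor and let $s$ be the almost sure value of $\dim_H F_\omega$. Let $\varepsilon>0$. Then there exists a real number $\eta_0>0$ such that, with $\beta_0=\eta_0\operatorname{Var}(\log\mathfrak{S}_{\omega_1}^s)$, \[ \mathscr{H}^{h_1(t,\beta_0,-\varepsilon)}(F_\omega)=\infty \] almost surely.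
   Context: **Random iterated function system (RIFS).** $\Lambda\subset\mathbb{R}^k$ is a non-empty compact set with a Borel probability measure $\mu$. For each $\lambda\in\Lambda$, $\mathbb{I}_\lambda=\{f_\lambda^1,\dots,f_\lambda^{\mathcal{N}_\lambda}\}$, $\mathcal{N}_\lambda\in\mathbb{N}$, $\mathcal{N}_\lambda\ge1$, is a finite family of maps of $\mathbb{R}^d$ with $|f_\lambda^i(x)-f_\lambda^i(y)|=c_\lambda^i|x-y|$, $c_\lambda^i\in(0,1)$. Put $\mathbb{L}=\{\mathbb{I}_\lambda\}_{\lambda\in\Lambda}$; the pair $(\mathbb{L},\mu)$ is the RIFS. The dependence on $\lambda$ is understood to be measurable, and there is a compact $\Delta\subset\mathbb{R}^d$ with $f_\lambda^i(\Delta)\subseteq\Delta$ for all $\lambda,i$. **UOSC.** There is a non-empty bounded open set $\mathcal{O}\subset\mathbb{R}^d$ with $f_\lambda^i(\mathcal{O})\subseteq\mathcal{O}$ and $f_\lambda^i(\mathcal{O})\cap f_\lambda^j(\mathcal{O})=\varnothing$ for all $\lambda\in\Lambda$, $1\le i\neq j\le\mathcal{N}_\lambda$. **Random homogeneous attractor.** $\Omega=\Lambda^{\mathbb{N}}$ with the product measure $\mathbb{P}_H=\mu^{\mathbb{N}}$; "almost surely", $\mathbb{E}$ and $\operatorname{Var}$ refer to $\mathbb{P}_H$. For $\omega=\omega_1\omega_2\cdots\in\Omega$, \[F_\omega=\bigcap_{k=1}^\infty\ \bigcup_{1\le j_i\le\mathcal{N}_{\omega_i},\,1\le i\le k} f_{\omega_1}^{j_1}\circ\cdots\circ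 f_{\omega_k}^{j_k}(\Delta).\] **Notation.** $\mathfrak{S}_\lambda^s=\sum_{j=1}^{\mathcal{N}_\lambda}(c_\lambda^j)^s$. Under these assumptions it is known that $\dim_H F_\omega$ is almost surely the unique $s$ with $\mathbb{E}(\log\mathfrak{S}_{\omega_1}^s)=0$. The RIFS is *almost deterministic* if there is $s$ with $\mathfrak{S}_\lambda^s=1$ for $\mu$-almost every $\lambda$. **Gauge function.** For $\beta>0$, $\gamma\in\mathbb{R}$ and small $t>0$, \[h_1(t,\beta,\gamma)=t^s\Big(\exp\sqrt{2\beta\,(\log(1/t))\,(\log\log\log(1/t^\beta))}\Big)^{1-\gamma},\] where $\log\log\log(1/t^\beta)=\log\log(\beta\log(1/t))$. A function given by such a formula is used as a gauge function on an interval $(0,r_0]$ on which it is defined and non-decreasing, and is extended by the constant value at $r_0$ for $t>r_0$ (and $0$ at $0$). $\mathscr{H}^h(F)=\lim_{\delta\to0}\inf\{\sum_i h(|U_i|) : \{U_i\}$ a countable cover of $F$ by sets of diameter $|U_i|\le\delta\}$. *)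

theory Defs
  imports "HOL-Probability.Probability"
begin

subsection \<open>Hausdorff measures and Hausdorff dimension\<close>

text \<open>
  The library's \<^const>\<open>diameter\<close> is only meaningful for bounded sets, hence the boundedness
  requirement. A finite cover is a sequence that is eventually empty: \<^term>\<open>diameter {} = 0\<close>, and
  every gauge function used below vanishes at \<^term>\<open>0::real\<close>.
\<close>

definition delta_covers :: "real \<Rightarrow> 'a::metric_space set \<Rightarrow> (nat \<Rightarrow> 'a set) set" where
  "delta_covers \<delta> F = {U. F \<subseteq> (\<Union>i. U i) \<and> (\<forall>i. bounded (U i) \<and> diameter (U i) \<le> \<delta>)}"

definition hausdorff_premeasure :: "(real \<Rightarrow> real) \<Rightarrow> real \<Rightarrow> 'a::metric_space set \<Rightarrow> ennreal" where
  "hausdorff_premeasure h \<delta> F = (INF U\<in>delta_covers \<delta> F. \<Sum>i. ennreal (h (diameter (U i))))"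

definition hausdorff_measure :: "(real \<Rightarrow> real) \<Rightarrow> 'a::metric_space set \<Rightarrow> ennreal" where
  "hausdorff_measure h F = Lim (at_right 0) (\<lambda>\<delta>. hausdorff_premeasure h \<delta> F)"

lemma hausdorff_premeasure_antimono:
  assumes "\<delta> \<le> \<delta>'"
  shows "hausdorff_premeasure h \<delta>' F \<le> hausdorff_premeasure h \<delta> F"
proof -
  have "delta_covers \<delta> F \<subseteq> delta_covers \<delta>' F"
    using assms order_trans unfolding delta_covers_def by blast
  then show ?thesis
    unfolding hausdorff_premeasure_def by (rule INF_superset_mono) simp
qed

lemma tendsto_hausdorff_premeasure:
  "((\<lambda>\<delta>. hausdorff_premeasure h \<delta> F) \<longlongrightarrow> (SUP \<delta>\<in>{0<..}. hausdorff_premeasure h \<delta> F)) (at_right 0)"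
proof (rule order_tendstoI)
  fix a assume "a < (SUP \<delta>\<in>{0<..}. hausdorff_premeasure h \<delta> F)"
  then obtain d where d: "d > 0" "a < hausdorff_premeasure h d F"
    by (auto simp: less_SUP_iff)
  have "eventually (\<lambda>\<delta>. \<delta> < d) (at_right 0)"
    using d(1) eventually_at_right_field by blast
  then show "eventually (\<lambda>\<delta>. a < hausdorff_premeasure h \<delta> F) (at_right 0)"
  proof eventually_elim
    case (elim \<delta>)
    then show ?case
      using less_le_trans[OF d(2) hausdorff_premeasure_antimono[of \<delta> d h F]] by simp
  qed
next
  fix a assume a: "(SUP \<delta>\<in>{0<..}. hausdorff_premeasure h \<delta> F) < a"
  have "eventually (\<lambda>\<delta>::real. \<delta> > 0) (at_right 0)"
    by (simp add: eventually_at_right_less)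
  then show "eventually (\<lambda>\<delta>. hausdorff_premeasure h \<delta> F < a) (at_right 0)"
  proof eventually_elim
    case (elim \<delta>)
    then have "hausdorff_premeasure h \<delta> F \<le> (SUP \<delta>\<in>{0<..}. hausdorff_premeasure h \<delta> F)"
      by (intro SUP_upper) simp
    then show ?case
      using a by (rule le_less_trans)
  qed
qed

lemma hausdorff_measure_eq_SUP:
  "hausdorff_measure h F = (SUP \<delta>\<in>{0<..}. hausdorff_premeasure h \<delta> F)"
  unfolding hausdorff_measure_def
  by (rule tendsto_Lim[OF _ tendsto_hausdorff_premeasure]) simp

text \<open>
  The infimum runs over positive exponents only, because \<^prop>\<open>0 powr (0::real) = 0\<close> does not give
  the counting measure for exponent \<^term>\<open>0::real\<close>; including that exponent would not change the
  infimum. In a Euclidean space every exponent above the dimension belongs to the set.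
\<close>

definition hausdorff_dim :: "'a::euclidean_space set \<Rightarrow> real" where
  "hausdorff_dim F = Inf {s. 0 < s \<and> hausdorff_measure (\<lambda>t. t powr s) F = 0}"


subsection \<open>Random iterated function systems\<close>

text \<open>
  The family attached to \<open>l \<in> \<Lambda>\<close> is \<open>f l 1, \<dots>, f l (N l)\<close>; the values of \<open>f l i\<close> and \<open>c l i\<close> for
  \<open>l \<notin> \<Lambda>\<close> or for \<open>i \<notin> {1..N l}\<close> are irrelevant. Measurable dependence on \<open>l\<close> is pointwise
  measurability of \<open>l \<mapsto> f l i x\<close> on the set where the \<open>i\<close>-th map exists; since each map is
  continuous this is the same as joint measurability in \<open>(l, x)\<close>. The set \<open>\<Delta>\<close> must be non-empty,
  as otherwise all attractors would be empty.
\<close>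

locale rifs = prob_space \<mu>
  for \<Lambda> :: "(real^'k) set"
  and \<mu> :: "(real^'k) measure"
  and N :: "real^'k \<Rightarrow> nat"
  and f :: "real^'k \<Rightarrow> nat \<Rightarrow> real^'d \<Rightarrow> real^'d"
  and c :: "real^'k \<Rightarrow> nat \<Rightarrow> real"
  and \<Delta> :: "(real^'d) set" +
  assumes compact_index: "compact \<Lambda>"
    and index_nonempty: "\<Lambda> \<noteq> {}"
    and sets_index_measure: "sets \<mu> = sets (restrict_space borel \<Lambda>)"
    and N_ge_1: "\<And>l. l \<in> \<Lambda> \<Longrightarrow> 1 \<le> N l"
    and ratio: "\<And>l i. \<lbrakk>l \<in> \<Lambda>; i \<in> {1..N l}\<rbrakk> \<Longrightarrow> 0 < c l i \<and> c l i < 1"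
    and similarity: "\<And>l i x y. \<lbrakk>l \<in> \<Lambda>; i \<in> {1..N l}\<rbrakk> \<Longrightarrow> norm (f l i x - f l i y) = c l i * norm (x - y)"
    and measurable_N: "N \<in> measurable \<mu> (count_space UNIV)"
    and measurable_ratio: "\<And>i. 1 \<le> i \<Longrightarrow>
      (\<lambda>l. c l i) \<in> borel_measurable (restrict_space \<mu> {l \<in> \<Lambda>. i \<le> N l})"
    and measurable_maps: "\<And>i x. 1 \<le> i \<Longrightarrow>
      (\<lambda>l. f l i x) \<in> borel_measurable (restrict_space \<mu> {l \<in> \<Lambda>. i \<le> N l})"
    and compact_invariant: "compact \<Delta>"
    and invariant_nonempty: "\<Delta> \<noteq> {}"
    and invariant: "\<And>l i. \<lbrakk>l \<in> \<Lambda>; i \<in> {1..N l}\<rbrakk> \<Longrightarrow> f l i ` \<Delta> \<subseteq> \<Delta>"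

definition UOSC ::
  "(real^'k) set \<Rightarrow> (real^'k \<Rightarrow> nat) \<Rightarrow> (real^'k \<Rightarrow> nat \<Rightarrow> real^'d \<Rightarrow> real^'d) \<Rightarrow> bool" where
  "UOSC \<Lambda> N f \<longleftrightarrow> (\<exists>V. V \<noteq> {} \<and> bounded V \<and> open V \<and>
     (\<forall>l\<in>\<Lambda>. \<forall>i\<in>{1..N l}. f l i ` V \<subseteq> V) \<and>
     (\<forall>l\<in>\<Lambda>. \<forall>i\<in>{1..N l}. \<forall>j\<in>{1..N l}. i \<noteq> j \<longrightarrow> f l i ` V \<inter> f l j ` V = {}))"

definition ratio_sum ::
  "(real^'k \<Rightarrow> nat) \<Rightarrow> (real^'k \<Rightarrow> nat \<Rightarrow> real) \<Rightarrow> real \<Rightarrow> real^'k \<Rightarrow> real" where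
  "ratio_sum N c s l = (\<Sum>j=1..N l. c l j powr s)"

definition almost_deterministic ::
  "(real^'k) measure \<Rightarrow> (real^'k \<Rightarrow> nat) \<Rightarrow> (real^'k \<Rightarrow> nat \<Rightarrow> real) \<Rightarrow> bool" where
  "almost_deterministic \<mu> N c \<longleftrightarrow> (\<exists>s. AE l in \<mu>. ratio_sum N c s l = 1)"


subsection \<open>Random homogeneous attractors\<close>

text \<open>Sequences are indexed from \<open>0\<close>: the letter \<open>\<omega>\<^sub>1\<close> is \<open>\<omega> 0\<close>.\<close>

definition P_H :: "(real^'k) measure \<Rightarrow> (nat \<Rightarrow> real^'k) measure" where
  "P_H \<mu> = PiM UNIV (\<lambda>_. \<mu>)"

text \<open>
  \<open>word_map f \<omega> j k = f (\<omega> 0) (j 0) \<circ> \<dots> \<circ> f (\<omega> (k - 1)) (j (k - 1))\<close>.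
\<close>

primrec word_map ::
  "(real^'k \<Rightarrow> nat \<Rightarrow> real^'d \<Rightarrow> real^'d) \<Rightarrow> (nat \<Rightarrow> real^'k) \<Rightarrow> (nat \<Rightarrow> nat) \<Rightarrow> nat \<Rightarrow> real^'d \<Rightarrow> real^'d"
where
  "word_map f \<omega> j 0 = id"
| "word_map f \<omega> j (Suc k) = word_map f \<omega> j k \<circ> f (\<omega> k) (j k)"

definition attractor ::
  "(real^'k \<Rightarrow> nat) \<Rightarrow> (real^'k \<Rightarrow> nat \<Rightarrow> real^'d \<Rightarrow> real^'d) \<Rightarrow> (real^'d) set \<Rightarrow>
    (nat \<Rightarrow> real^'k) \<Rightarrow> (real^'d) set" where
  "attractor N f \<Delta> \<omega> =
    (\<Inter>k\<in>{1..}. \<Union>j\<in>PiE {..<k} (\<lambda>i. {1..N (\<omega> i)}). word_map f \<omega> j k ` \<Delta>)"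


subsection \<open>The gauge function\<close>

definition h1 :: "real \<Rightarrow> real \<Rightarrow> real \<Rightarrow> real \<Rightarrow> real" where
  "h1 s \<beta> \<gamma> t =
    t powr s * (exp (sqrt (2 * \<beta> * ln (1 / t) * ln (ln (ln (1 / t powr \<beta>)))))) powr (1 - \<gamma>)"

text \<open>
  On \<open>(0, r]\<close> the formula is defined (all logarithms are taken of positive numbers and the square
  root of a non-negative one; \<^const>\<open>ln\<close> and \<^const>\<open>sqrt\<close> are total here) and non-decreasing.
\<close>

definition h1_gauge_on :: "real \<Rightarrow> real \<Rightarrow> real \<Rightarrow> real \<Rightarrow> bool" where
  "h1_gauge_on s \<beta> \<gamma> r \<longleftrightarrow> 0 < r \<and>
    (\<forall>t\<in>{0<..r}. 0 < ln (1 / t powr \<beta>) \<and> 0 < ln (ln (1 / t powr \<beta>)) \<and>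
       0 \<le> 2 * \<beta> * ln (1 / t) * ln (ln (ln (1 / t powr \<beta>)))) \<and>
    mono_on {0<..r} (h1 s \<beta> \<gamma>)"

definition gauge_extend :: "(real \<Rightarrow> real) \<Rightarrow> real \<Rightarrow> real \<Rightarrow> real" where
  "gauge_extend h r t = (if t \<le> 0 then 0 else if t \<le> r then h t else h r)"

end

theory Submission
  imports Defs "HOL-Real_Asymp.Real_Asymp"
begin

text \<open>
  The maps \<open>f l 1, \<dots>, f l (N l)\<close> share one ratio, so the cylinders of level \<open>k\<close> all have the same size
  \<open>r\<^sub>k = c(\<omega>\<^sub>1) \<cdots> c(\<omega>\<^sub>k)\<close>, and there are \<open>P\<^sub>k = N(\<omega>\<^sub>1) \<cdots> N(\<omega>\<^sub>k)\<close> of them. By the open set condition a set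
  of diameter comparable to \<open>r\<^sub>k\<close> meets a bounded number of them; counting the cylinders of a deep
  level then shows that every cover by sets of sizes \<open>r\<^bsub>k(i)\<^esub>\<close> satisfies \<open>\<Sum>\<^sub>i 1 / P\<^bsub>k(i)\<^esub> \<ge> 1 / M\<close>, with no
  need for a mass distribution. Hence the measure is infinite as soon as \<open>P\<^sub>k h(r\<^sub>k) \<rightarrow> \<infinity>\<close>.
  Since \<open>\<eta>\<^sub>0\<close> is free, the iterated logarithm law for \<open>ln P\<^sub>k\<close> and \<open>ln r\<^sub>k\<close> is only needed up to a
  constant, and this follows from a maximal inequality, Hoeffding's lemma and Borel-Cantelli along
  dyadic blocks. The same estimates give \<open>dim F\<^sub>\<omega> = E(ln N) / - E(ln c)\<close>, so \<open>ln S\<^sup>s\<close> is centred,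
  and its variance is positive unless the system is almost deterministic.
\<close>

subsection \<open>An iterated logarithm bound\<close>

text \<open>The sequence space is the image of \<open>M\<close> times itself under prepending a
  letter, so Tonelli's theorem splits off the first coordinate.\<close>

lemma (in prob_space) nn_integral_PiM_iter:
  assumes [measurable]: "F \<in> borel_measurable (\<Pi>\<^sub>M i\<in>(UNIV::nat set). M)"
  shows "(\<integral>\<^sup>+\<omega>. F \<omega> \<partial>(\<Pi>\<^sub>M i\<in>(UNIV::nat set). M)) =
    (\<integral>\<^sup>+x. \<integral>\<^sup>+\<omega>. F (case_nat x \<omega>) \<partial>(\<Pi>\<^sub>M i\<in>(UNIV::nat set). M) \<partial>M)"
proof -
  interpret S: sequence_space M ..
  interpret P: pair_sigma_finite M "\<Pi>\<^sub>M i::nat\<in>UNIV. M" ..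
  have "(\<integral>\<^sup>+\<omega>. F \<omega> \<partial>S.S) = (\<integral>\<^sup>+X. F ((\<lambda>(s, \<omega>). case_nat s \<omega>) X) \<partial>(M \<Otimes>\<^sub>M S.S))"
    by (subst S.PiM_iter[symmetric]) (simp add: nn_integral_distr)
  also have "\<dots> = (\<integral>\<^sup>+x. \<integral>\<^sup>+\<omega>. F ((\<lambda>(s, \<omega>). case_nat s \<omega>) (x, \<omega>)) \<partial>S.S \<partial>M)"
    by (subst S.nn_integral_fst) simp_all
  finally show ?thesis by simp
qed

text \<open>Conditioning on the first factor replaces \<open>z\<close> by \<open>z * Y x\<close>, which makes an induction on \<open>n\<close> work
  without any martingale theory.\<close>

lemma (in prob_space) prod_maximal_inequality:
  fixes Y :: "'a \<Rightarrow> ennreal"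
  assumes Y [measurable]: "Y \<in> borel_measurable M" and Y1: "(\<integral>\<^sup>+x. Y x \<partial>M) \<le> 1"
  shows "emeasure (\<Pi>\<^sub>M i\<in>(UNIV::nat set). M)
    {\<omega> \<in> space (\<Pi>\<^sub>M i\<in>(UNIV::nat set). M). \<exists>k\<le>n. 1 \<le> z * (\<Prod>i<k. Y (\<omega> i))} \<le> z"
proof -
  interpret S: sequence_space M ..
  have [simp]: "emeasure S.S A \<le> 1" for A
    by (rule S.P.emeasure_le_1)
  define A where "A n z = {\<omega> \<in> space S.S. \<exists>k\<le>n. 1 \<le> z * (\<Prod>i<k. Y (\<omega> i))}" for n z
  have A [measurable]: "A n z \<in> sets S.S" for n z
    unfolding A_def by measurable
  have "emeasure S.S (A n z) \<le> z"
  proof (induction n arbitrary: z)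
    case 0
    show ?case
    proof (cases "1 \<le> z")
      case True
      then show ?thesis by (rule order_trans[rotated]) simp
    next
      case False
      then have "A 0 z = {}" by (auto simp: A_def)
      then show ?thesis by simp
    qed
  next
    case (Suc n)
    show ?case
    proof (cases "1 \<le> z")
      case True
      then show ?thesis by (rule order_trans[rotated]) simp
    next
      case False
      \<comment> \<open>As \<open>z < 1\<close>, the threshold is not met at \<open>k = 0\<close>.
        At a later \<open>k\<close> the factor \<open>Y x\<close> moves into the starting value, so
        the tail \<open>\<omega>\<close> meets the threshold from \<open>z * Y x\<close> with one
        step less.\<close>
      have *: "indicator (A (Suc n) z) (case_nat x \<omega>) \<le> (indicator (A n (z * Y x)) \<omega> :: ennreal)"
        if "\<omega> \<in> space S.S" for x \<omega>
      proof (cases "case_nat x \<omega> \<in> A (Suc n) z")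
        case True
        then obtain k where k: "k \<le> Suc n" "1 \<le> z * (\<Prod>i<k. Y (case_nat x \<omega> i))"
          by (auto simp: A_def)
        with False obtain k' where k': "k = Suc k'" by (cases k) auto
        have "1 \<le> (z * Y x) * (\<Prod>i<k'. Y (\<omega> i))"
          using k(2) unfolding k' prod.lessThan_Suc_shift by (simp add: mult.assoc)
        then have "\<omega> \<in> A n (z * Y x)"
          using that k(1) k' by (auto simp: A_def)
        then show ?thesis by (simp add: indicator_def)
      qed simp
      have "emeasure S.S (A (Suc n) z) = (\<integral>\<^sup>+\<omega>. indicator (A (Suc n) z) \<omega> \<partial>S.S)"
        by simp
      also have "\<dots> = (\<integral>\<^sup>+x. \<integral>\<^sup>+\<omega>. indicator (A (Suc n) z) (case_nat x \<omega>) \<partial>S.S \<partial>M)"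
        by (rule nn_integral_PiM_iter) measurable
      also have "\<dots> \<le> (\<integral>\<^sup>+x. \<integral>\<^sup>+\<omega>. indicator (A n (z * Y x)) \<omega> \<partial>S.S \<partial>M)"
        by (intro nn_integral_mono *)
      also have "\<dots> \<le> (\<integral>\<^sup>+x. z * Y x \<partial>M)"
        by (intro nn_integral_mono) (simp add: Suc.IH)
      also have "\<dots> \<le> z"
        using mult_left_mono[OF Y1, of z] by (simp add: nn_integral_cmult)
      finally show ?thesis .
    qed
  qed
  then show ?thesis by (simp add: A_def)
qed

section \<open>Fluctuations of sums along dyadic blocks\<close>

text \<open>The easy half of the iterated logarithm law, with an unspecified constant. Hoeffding's
  lemma bounds the mean of each exponential factor by 1, the maximal inequality controls all
  \<open>k\<close> up to a power of 2 at once, and the exceptional probabilities are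
  summable.\<close>

lemma (in prob_space) AE_sum_le_iterated_log:
  fixes g :: "'a \<Rightarrow> real"
  assumes g [measurable]: "g \<in> borel_measurable M" and gb: "\<And>x. x \<in> space M \<Longrightarrow> \<bar>g x\<bar> \<le> b"
    and g0: "expectation g = 0"
  shows "\<exists>C\<ge>0. AE \<omega> in (\<Pi>\<^sub>M i\<in>(UNIV::nat set). M).
    eventually (\<lambda>n. (\<Sum>i<n. g (\<omega> i)) \<le> C * sqrt (real n * ln (ln (real n)))) sequentially"
proof -
  interpret S: sequence_space M ..
  interpret H: interval_bounded_random_variable M g "-b" b
    by unfold_locales (use gb in \<open>auto simp: abs_le_iff intro!: AE_I2\<close>, force)
  obtain x0 where "x0 \<in> space M" using not_empty by auto
  then have "b \<ge> 0" using gb[of x0] by simp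
  \<comment> \<open>\<open>L m\<close> is tuned to times up to \<open>2 ^ m\<close>, where
    \<open>ln m\<close> has the order of \<open>ln (ln n)\<close>: then \<open>2 ^ m\<close> times
    the Hoeffding exponent \<open>v m\<close> for the interval \<open>[-b, b]\<close> is only
    \<open>b\<^sup>2 / 2 * ln m\<close>.\<close>
  define L where "L m = sqrt (ln (real m) / 2 ^ m)" for m
  define v where "v m = (L m)\<^sup>2 * (2 * b)\<^sup>2 / 8" for m
  define Y where "Y m x = ennreal (exp (L m * g x - v m))" for m x
  have Lpos: "L m > 0" if "m \<ge> 2" for m
    using that by (auto simp: L_def)
  have Y1: "(\<integral>\<^sup>+x. Y m x \<partial>M) \<le> 1" if "m \<ge> 2" for m
  proof -
    have "(\<integral>\<^sup>+x. Y m x \<partial>M) = (\<integral>\<^sup>+x. ennreal (exp (- v m)) * ennreal (exp (L m * g x)) \<partial>M)"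
      unfolding Y_def
      by (intro nn_integral_cong) (simp flip: ennreal_mult exp_add)
    also have "\<dots> = ennreal (exp (- v m)) * (\<integral>\<^sup>+x. ennreal (exp (L m * g x)) \<partial>M)"
      by (intro nn_integral_cmult) measurable
    also have "\<dots> \<le> ennreal (exp (- v m)) * ennreal (exp (v m))"
      using H.Hoeffdings_lemma_nn_integral_0[OF Lpos[OF that] g0]
      by (intro mult_left_mono) (simp_all add: v_def)
    also have "\<dots> = 1"
      by (simp flip: ennreal_mult exp_add)
    finally show ?thesis .
  qed
  \<comment> \<open>The shift by 2 keeps the logarithm in \<open>L\<close> positive; the starting
    value \<open>1 / (m+2)^2\<close> is the summable probability bound.\<close>
  define B where "B m = {\<omega> \<in> space S.S. \<exists>k\<le>2^(m+2). 1 \<le> ennreal (1 / real (m+2) ^ 2) * (\<Prod>i<k. Y (m+2) (\<omega> i))}" for m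
  have [measurable]: "Y m \<in> borel_measurable M" for m
    unfolding Y_def by measurable
  have B [measurable]: "B m \<in> sets S.S" for m
    unfolding B_def by measurable
  have "emeasure S.S (B m) \<le> ennreal (1 / real (m+2) ^ 2)" for m
    unfolding B_def by (rule prod_maximal_inequality) (auto intro!: Y1)
  then have Bm: "measure S.S (B m) \<le> 1 / real (m+2) ^ 2" for m
    by (simp add: S.P.emeasure_eq_measure del: of_nat_add)
  have "summable (\<lambda>m. 1 / real (m+2) ^ 2)"
    using inverse_power_summable[of 2, where ?'a = real]
    by (subst summable_iff_shift[of "\<lambda>m. 1 / real m ^ 2"]) (simp add: inverse_eq_divide)
  then have summ: "summable (\<lambda>m. measure S.S (B m))"
    by (rule summable_comparison_test'[where N = 0]) (use Bm in auto)
  have BC: "AE \<omega> in S.S. eventually (\<lambda>m. \<omega> \<in> space S.S - B m) sequentially"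
    by (rule borel_cantelli_AE1) (use summ in \<open>auto simp: S.P.emeasure_eq_measure\<close>)
  \<comment> \<open>The 2 is the exponent in the threshold \<open>(m+2)^2\<close>;
    \<open>b\<^sup>2 / 2\<close> comes from the accumulated compensation \<open>v\<close>.\<close>
  define C where "C = 2 + b\<^sup>2 / 2"
  have C: "C \<ge> 0" by (simp add: C_def)
  \<comment> \<open>Outside \<open>B m\<close> the product stays below the threshold; taking
    logarithms and dividing by \<open>L q\<close> gives the bound.\<close>
  have block: "(\<Sum>i<k. g (\<omega> i)) \<le> C * sqrt (2 ^ (m+2) * ln (real (m+2)))"
    if "\<omega> \<in> space S.S - B m" "k \<le> 2 ^ (m+2)" for \<omega> k m
  proof -
    define q where "q = m + 2"
    have q: "q \<ge> 2" by (simp add: q_def)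
    define R where "R = sqrt (2 ^ q * ln (real q))"
    have lnq: "ln (real q) > 0" using q by simp
    have LR: "L q * R = ln (real q)"
      using lnq by (simp add: L_def R_def real_sqrt_mult real_sqrt_divide)
    have L2: "(L q)\<^sup>2 * 2 ^ q = ln (real q)"
      using lnq by (simp add: L_def)
    have "\<not> 1 \<le> ennreal (1 / real q ^ 2) * (\<Prod>i<k. Y q (\<omega> i))"
      using that by (auto simp: B_def q_def)
    also have "(\<Prod>i<k. Y q (\<omega> i)) = ennreal (exp (L q * (\<Sum>i<k. g (\<omega> i)) - real k * v q))"
      unfolding Y_def
      by (subst prod_ennreal) (auto simp flip: exp_sum simp: sum_subtractf sum_distrib_left)
    finally have "\<not> ennreal 1 \<le> ennreal (1 / real q ^ 2 * exp (L q * (\<Sum>i<k. g (\<omega> i)) - real k * v q))"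
      by (simp flip: ennreal_mult)
    then have "1 / real q ^ 2 * exp (L q * (\<Sum>i<k. g (\<omega> i)) - real k * v q) < 1"
      by (auto simp: not_le ennreal_less_iff simp flip: ennreal_1)
    then have "exp (L q * (\<Sum>i<k. g (\<omega> i)) - real k * v q) < real q ^ 2"
      using q by (simp add: field_simps)
    also have "real q ^ 2 = exp (2 * ln (real q))"
      using q by (simp add: exp_double)
    finally have "L q * (\<Sum>i<k. g (\<omega> i)) < 2 * ln (real q) + real k * v q"
      by simp
    also have "real k * v q \<le> 2 ^ q * v q"
    proof (rule mult_right_mono)
      have "real k \<le> real (2 ^ q)" using that(2) unfolding q_def of_nat_le_iff .
      then show "real k \<le> 2 ^ q" by simp
    qed (simp add: v_def)
    also have "2 ^ q * v q = b\<^sup>2 / 2 * ln (real q)"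
      using L2 unfolding v_def by (simp add: field_simps power_mult_distrib)
    also have "2 * ln (real q) + b\<^sup>2 / 2 * ln (real q) = L q * (C * R)"
      unfolding LR[symmetric] C_def by (simp add: algebra_simps)
    finally have "L q * (\<Sum>i<k. g (\<omega> i)) < L q * (C * R)"
      by simp
    then show ?thesis
      using Lpos[OF q] by (simp add: R_def q_def)
  qed
  have ev: "eventually (\<lambda>n::nat. ln (1 + ln (real n) / ln 2) \<le> 2 * ln (ln (real n)) \<and> ln (ln (real n)) \<ge> 0) sequentially"
    by (intro eventually_conj; real_asymp)
  show ?thesis
  proof (intro exI[of _ "2 * C"] conjI)
    show "AE \<omega> in S.S. eventually (\<lambda>n. (\<Sum>i<n. g (\<omega> i)) \<le> 2 * C * sqrt (real n * ln (ln (real n)))) sequentially"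
      using BC
    proof eventually_elim
      case (elim \<omega>)
      then obtain m0 where m0: "\<And>m. m \<ge> m0 \<Longrightarrow> \<omega> \<in> space S.S - B m"
        by (auto simp: eventually_sequentially)
      show ?case
        using eventually_ge_at_top[of "2 ^ (m0 + 2)"] ev
      proof eventually_elim
        case (elim n)
        have "n \<ge> 1" using elim(1) by (meson le_trans one_le_numeral one_le_power)
        then obtain p where p: "2 ^ p \<le> n" "n < 2 ^ (p + 1)"
          using ex_power_ivl1[of 2 n] by auto
        have "2 ^ (m0 + 2) < (2::nat) ^ (p + 1)" using elim(1) p(2) by linarith
        then have pm: "m0 + 2 < p + 1" by (simp only: power_strict_increasing_iff)
        \<comment> \<open>The block bound for \<open>m\<close> reaches up to
          \<open>2 ^ (p + 1)\<close>, just beyond \<open>n\<close>. The subtraction is not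
          truncated, since \<open>pm\<close> forces \<open>p \<ge> 2\<close>.\<close>
        define m where "m = p - 1"
        have m: "m \<ge> m0" "m + 2 = p + 1" using pm by (auto simp: m_def)
        have "(\<Sum>i<n. g (\<omega> i)) \<le> C * sqrt (2 ^ (m+2) * ln (real (m+2)))"
          using p m by (intro block m0) auto
        \<comment> \<open>Passing from the block end to \<open>n\<close> costs a factor 2 in the
          length and a factor 2 in the logarithm; the root of their product doubles the
          constant.\<close>
        also have "\<dots> \<le> C * sqrt (2 ^ 2 * (real n * ln (ln (real n))))"
        proof (intro mult_left_mono C, simp only: real_sqrt_le_iff)
          have pn: "2 ^ p \<le> real n"
            using p(1) by (metis of_nat_le_iff of_nat_numeral of_nat_power)
          then have "real p * ln 2 \<le> ln (real n)"
            using \<open>n \<ge> 1\<close> by (subst ln_realpow[symmetric]) (auto simp: ln_le_cancel_iff)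
          then have "real (m + 2) \<le> 1 + ln (real n) / ln 2"
            unfolding m(2) by (simp add: field_simps)
          then have "ln (real (m + 2)) \<le> ln (1 + ln (real n) / ln 2)"
            by (subst ln_le_cancel_iff) auto
          also have "\<dots> \<le> 2 * ln (ln (real n))" using elim by simp
          finally have "ln (real (m + 2)) \<le> 2 * ln (ln (real n))" .
          moreover have "2 ^ (m + 2) \<le> 2 * real n"
            using pn unfolding m(2) by simp
          ultimately have "2 ^ (m + 2) * ln (real (m + 2)) \<le> (2 * real n) * (2 * ln (ln (real n)))"
            by (intro mult_mono) auto
          then show "2 ^ (m + 2) * ln (real (m + 2)) \<le> 2 ^ 2 * (real n * ln (ln (real n)))"
            by simp
        qed
        also have "\<dots> = 2 * C * sqrt (real n * ln (ln (real n)))"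
          by (simp only: real_sqrt_mult real_sqrt_power) simp
        finally show ?case .
      qed
    qed
  qed (use C in simp)
qed

text \<open>The one-sided bound is applied to \<open>g - m\<close> and to \<open>m - g\<close>,
  which are centred and bounded by \<open>b + \<bar>m\<bar>\<close>.\<close>

lemma (in prob_space) AE_abs_sum_le_iterated_log:
  fixes g :: "'a \<Rightarrow> real"
  assumes g [measurable]: "g \<in> borel_measurable M" and gb: "\<And>x. x \<in> space M \<Longrightarrow> \<bar>g x\<bar> \<le> b"
  shows "\<exists>C\<ge>0. AE \<omega> in (\<Pi>\<^sub>M i\<in>(UNIV::nat set). M). eventually (\<lambda>n.
    \<bar>(\<Sum>i<n. g (\<omega> i)) - real n * expectation g\<bar> \<le> C * sqrt (real n * ln (ln (real n)))) sequentially"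
proof -
  define m where "m = expectation g"
  have int: "integrable M g"
    by (rule integrable_const_bound[where B = b]) (use gb in auto)
  have "\<exists>C\<ge>0. AE \<omega> in (\<Pi>\<^sub>M i\<in>(UNIV::nat set). M).
    eventually (\<lambda>n. (\<Sum>i<n. g (\<omega> i) - m) \<le> C * sqrt (real n * ln (ln (real n)))) sequentially"
    by (rule AE_sum_le_iterated_log[where b = "b + \<bar>m\<bar>"])
       (use gb int in \<open>auto simp: m_def prob_space intro: order_trans[OF abs_triangle_ineq4] add_mono\<close>)
  then obtain C1 where C1: "C1 \<ge> 0" "AE \<omega> in (\<Pi>\<^sub>M i\<in>(UNIV::nat set). M).
    eventually (\<lambda>n. (\<Sum>i<n. g (\<omega> i) - m) \<le> C1 * sqrt (real n * ln (ln (real n)))) sequentially" by auto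
  have "\<exists>C\<ge>0. AE \<omega> in (\<Pi>\<^sub>M i\<in>(UNIV::nat set). M).
    eventually (\<lambda>n. (\<Sum>i<n. m - g (\<omega> i)) \<le> C * sqrt (real n * ln (ln (real n)))) sequentially"
    by (rule AE_sum_le_iterated_log[where b = "\<bar>m\<bar> + b"])
       (use gb int in \<open>auto simp: m_def prob_space intro: order_trans[OF abs_triangle_ineq4] add_mono\<close>)
  then obtain C2 where C2: "C2 \<ge> 0" "AE \<omega> in (\<Pi>\<^sub>M i\<in>(UNIV::nat set). M).
    eventually (\<lambda>n. (\<Sum>i<n. m - g (\<omega> i)) \<le> C2 * sqrt (real n * ln (ln (real n)))) sequentially" by auto
  have ev: "eventually (\<lambda>n::nat. ln (ln (real n)) \<ge> 0) sequentially"
    by real_asymp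
  show ?thesis
  proof (intro exI[of _ "C1 + C2"] conjI)
    show "AE \<omega> in (\<Pi>\<^sub>M i\<in>(UNIV::nat set). M). eventually (\<lambda>n.
      \<bar>(\<Sum>i<n. g (\<omega> i)) - real n * expectation g\<bar> \<le> (C1 + C2) * sqrt (real n * ln (ln (real n)))) sequentially"
      using C1(2) C2(2)
    proof eventually_elim
      case (elim \<omega>)
      show ?case using elim ev
      proof eventually_elim
        case (elim n)
        define R where "R = sqrt (real n * ln (ln (real n)))"
        have "R \<ge> 0" using elim(3) by (simp add: R_def)
        then have "C1 * R \<ge> 0" "C2 * R \<ge> 0" using C1 C2 by auto
        then show ?case
          using elim(1,2) unfolding R_def[symmetric] m_def[symmetric]
          by (simp add: sum_subtractf ring_distribs abs_le_iff)
      qed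
    qed
  qed (use C1 C2 in simp)
qed

subsection \<open>Counting cylinders\<close>

text \<open>Translated to fix the origin and divided by \<open>r\<close>, the map is an isometry,
  hence orthogonal and onto in finite dimension.\<close>

lemma similarity_surj:
  fixes g :: "'a::euclidean_space \<Rightarrow> 'a"
  assumes "0 < r" and sim: "\<And>x y. norm (g x - g y) = r * norm (x - y)"
  shows "surj g"
proof -
  define h where "h x = (g x - g 0) /\<^sub>R r" for x
  have "dist (h x) (h y) = dist x y" for x y
    using assms unfolding h_def dist_norm
    by (simp flip: scaleR_diff_right)
  then have "orthogonal_transformation h"
    by (simp add: orthogonal_transformation_isometry) (simp add: h_def)
  then have "surj h"
    by (rule orthogonal_transformation_surj)
  then have "\<exists>x. y = g x" for y
  proof -
    obtain x where "(y - g 0) /\<^sub>R r = h x"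
      using surjD[OF \<open>surj h\<close>] by blast
    then have "y = g x"
      using \<open>0 < r\<close> by (simp add: h_def)
    then show ?thesis ..
  qed
  then show ?thesis by (auto simp: surj_def)
qed

text \<open>After rescaling by \<open>r\<close> the points lie in a fixed ball at mutual distance at
  least \<open>\<rho>\<close>. Finitely many balls of radius \<open>\<rho> / 2\<close> cover it, and
  each holds at most one point, so \<open>M\<close> is independent of \<open>r\<close> and of the
  centre.\<close>

lemma separated_card_le:
  fixes R \<rho> :: real
  assumes "0 < \<rho>"
  shows "\<exists>M>0. \<forall>r>0. \<forall>(x::'a::euclidean_space) p Q.
    (\<forall>w\<in>Q. norm (p w - x) \<le> R * r) \<longrightarrow> (\<forall>w\<in>Q. \<forall>w'\<in>Q. w \<noteq> w' \<longrightarrow> \<rho> * r \<le> norm (p w - p w'))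
    \<longrightarrow> card (Q :: 'b set) \<le> M"
proof -
  have "compact (cball (0::'a) R)" by simp
  then have "\<exists>K. finite K \<and> cball (0::'a) R \<subseteq> (\<Union>k\<in>K. ball k (\<rho> / 2))"
    using assms half_gt_zero[of \<rho>] unfolding compact_eq_totally_bounded by (elim conjE allE[of _ "\<rho> / 2"]) simp
  then obtain K where K: "finite K" "cball (0::'a) R \<subseteq> (\<Union>k\<in>K. ball k (\<rho> / 2))"
    by auto
  show ?thesis
  proof (intro exI[of _ "Suc (card K)"] conjI allI impI)
    fix x :: 'a and r :: real and Q :: "'b set" and p
    assume r: "0 < r" and "\<forall>w\<in>Q. norm (p w - x) \<le> R * r"
      and "\<forall>w\<in>Q. \<forall>w'\<in>Q. w \<noteq> w' \<longrightarrow> \<rho> * r \<le> norm (p w - p w')"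
    then have near: "\<And>w. w \<in> Q \<Longrightarrow> norm (p w - x) \<le> R * r"
      and sep: "\<And>w w'. \<lbrakk>w \<in> Q; w' \<in> Q; w \<noteq> w'\<rbrakk> \<Longrightarrow> \<rho> * r \<le> norm (p w - p w')"
      by blast+
    have "\<exists>k\<in>K. dist k ((p w - x) /\<^sub>R r) < \<rho> / 2" if "w \<in> Q" for w
    proof -
      have "(p w - x) /\<^sub>R r \<in> cball 0 R"
        using near[OF that] r by (simp add: inverse_eq_divide pos_divide_le_eq)
      then show ?thesis using subsetD[OF K(2)] by (simp only: UN_iff mem_ball)
    qed
    then obtain k where k: "\<And>w. w \<in> Q \<Longrightarrow> k w \<in> K" "\<And>w. w \<in> Q \<Longrightarrow> dist (k w) ((p w - x) /\<^sub>R r) < \<rho> / 2"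
      by metis
    have "inj_on k Q"
    proof (rule inj_onI, rule ccontr)
      fix w w' assume w: "w \<in> Q" "w' \<in> Q" "k w = k w'" "w \<noteq> w'"
      have "dist ((p w - x) /\<^sub>R r) ((p w' - x) /\<^sub>R r) < \<rho>"
        using k(2)[OF w(1)] k(2)[OF w(2)] w(3)
        by (metis dist_commute dist_triangle_half_r)
      also have "dist ((p w - x) /\<^sub>R r) ((p w' - x) /\<^sub>R r) = norm (p w - p w') / r"
        unfolding dist_norm using r by (simp flip: scaleR_diff_right add: divide_inverse)
      finally show False
        using sep[OF w(1,2,4)] r by (simp add: field_simps)
    qed
    then have "card Q \<le> card K"
      by (rule card_inj_on_le) (use k(1) K(1) in auto)
    then show "card Q \<le> Suc (card K)" by simp
  qed simp
qed

section \<open>The equal-ratio setting and its cylinders\<close>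

text \<open>Fixes a witness \<open>V\<close> of the open set condition and a bound
  \<open>N_max\<close>. The common ratio is read off as \<open>c l 1\<close>, the index 1 being
  available because \<open>1 \<le> N l\<close>.\<close>

locale homogeneous_rifs = rifs \<Lambda> \<mu> N f c \<Delta>
  for \<Lambda> :: "(real^'k) set" and \<mu> N and f :: "real^'k \<Rightarrow> nat \<Rightarrow> real^'d \<Rightarrow> real^'d" and c \<Delta> +
  fixes V :: "(real^'d) set" and c_min c_max :: real and N_max :: nat
  assumes V_nonempty: "V \<noteq> {}" and open_V: "open V"
    and V_invariant: "\<And>l i. \<lbrakk>l \<in> \<Lambda>; i \<in> {1..N l}\<rbrakk> \<Longrightarrow> f l i ` V \<subseteq> V"
    and V_disjoint: "\<And>l i j. \<lbrakk>l \<in> \<Lambda>; i \<in> {1..N l}; j \<in> {1..N l}; i \<noteq> j\<rbrakk> \<Longrightarrow> f l i ` V \<inter> f l j ` V = {}"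
    and c_min_pos: "0 < c_min" and c_max_less_1: "c_max < 1"
    and equal_ratios: "\<And>l i. \<lbrakk>l \<in> \<Lambda>; i \<in> {1..N l}\<rbrakk> \<Longrightarrow> c l i = c l 1"
    and ratio_bounds: "\<And>l. l \<in> \<Lambda> \<Longrightarrow> c_min \<le> c l 1 \<and> c l 1 \<le> c_max"
    and N_le_max: "\<And>l. l \<in> \<Lambda> \<Longrightarrow> N l \<le> N_max"
begin

definition radius :: "(nat \<Rightarrow> real^'k) \<Rightarrow> nat \<Rightarrow> real" where
  "radius \<omega> k = (\<Prod>i<k. c (\<omega> i) 1)"

definition number :: "(nat \<Rightarrow> real^'k) \<Rightarrow> nat \<Rightarrow> nat" where
  "number \<omega> k = (\<Prod>i<k. N (\<omega> i))"

text \<open>Extensional functions make equality of words mean agreement of the first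
  \<open>k\<close> letters, so that words can be counted.\<close>

definition words :: "(nat \<Rightarrow> real^'k) \<Rightarrow> nat \<Rightarrow> (nat \<Rightarrow> nat) set" where
  "words \<omega> k = PiE {..<k} (\<lambda>i. {1..N (\<omega> i)})"

definition level :: "(nat \<Rightarrow> real^'k) \<Rightarrow> nat \<Rightarrow> (real^'d) set" where
  "level \<omega> k = (\<Union>j\<in>words \<omega> k. word_map f \<omega> j k ` \<Delta>)"

lemma c1_bounds: "l \<in> \<Lambda> \<Longrightarrow> 0 < c l 1" "l \<in> \<Lambda> \<Longrightarrow> c l 1 < 1"
  using ratio_bounds[of l] c_min_pos c_max_less_1 by auto

lemma c_max_pos: "0 < c_max"
proof -
  obtain l where "l \<in> \<Lambda>" using index_nonempty by auto
  then have "c_min \<le> c_max" using ratio_bounds[of l] by linarith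
  then show ?thesis using c_min_pos by linarith
qed

lemma attractor_eq: "attractor N f \<Delta> \<omega> = (\<Inter>k\<in>{1..}. level \<omega> k)"
  by (simp add: attractor_def level_def words_def)

lemma finite_words [simp]: "finite (words \<omega> k)"
  by (simp add: words_def finite_PiE)

lemma card_words: "card (words \<omega> k) = number \<omega> k"
  by (simp add: words_def number_def card_PiE)

lemma wordsD: "w \<in> words \<omega> k \<Longrightarrow> i < k \<Longrightarrow> w i \<in> {1..N (\<omega> i)}"
  unfolding words_def by (erule PiE_mem) simp

lemma restrict_words: "w \<in> words \<omega> n \<Longrightarrow> k \<le> n \<Longrightarrow> restrict w {..<k} \<in> words \<omega> k"
  by (simp add: words_def PiE_iff)

lemma word_map_cong: "(\<And>i. i < k \<Longrightarrow> j i = j' i) \<Longrightarrow> word_map f \<omega> j k = word_map f \<omega> j' k"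
  by (induction k) auto

context
  fixes \<omega> :: "nat \<Rightarrow> real^'k" assumes range_\<omega>: "range \<omega> \<subseteq> \<Lambda>"
begin

private lemma \<omega>: "\<omega> i \<in> \<Lambda>"
  using range_\<omega> by auto

lemma radius_pos: "0 < radius \<omega> k"
  unfolding radius_def by (intro prod_pos c1_bounds \<omega>)

lemma number_pos: "0 < number \<omega> k"
  unfolding number_def using N_ge_1[OF \<omega>] by (intro prod_pos) (auto simp: Suc_le_eq)

text \<open>Consecutive radii are comparable; this lets every small diameter be matched with a level
  up to the factor \<open>c_min\<close>.\<close>

lemma radius_Suc_ge: "c_min * radius \<omega> k \<le> radius \<omega> (Suc k)"
  using ratio_bounds[OF \<omega>, of k] radius_pos[of k] by (simp add: radius_def)

lemma radius_Suc_less: "radius \<omega> (Suc k) < radius \<omega> k"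
  using c1_bounds(2)[OF \<omega>, of k] radius_pos[of k] by (simp add: radius_def)

lemma radius_mono: "k \<le> n \<Longrightarrow> radius \<omega> n \<le> radius \<omega> k"
  by (rule lift_Suc_antimono_le) (simp_all add: radius_Suc_less less_imp_le)

lemma radius_le_power: "radius \<omega> k \<le> c_max ^ k"
proof -
  have "radius \<omega> k \<le> (\<Prod>i<k. c_max)"
    unfolding radius_def using ratio_bounds[OF \<omega>] c1_bounds(1)[OF \<omega>]
    by (intro prod_mono) (auto simp: less_imp_le)
  then show ?thesis by simp
qed

lemma radius_tendsto_0: "radius \<omega> \<longlonglongrightarrow> 0"
proof (rule tendsto_sandwich[of "\<lambda>_. 0"])
  show "(\<lambda>k. c_max ^ k) \<longlonglongrightarrow> 0"
    using c_max_pos c_max_less_1 by (intro LIMSEQ_power_zero) auto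
qed (use radius_le_power radius_pos in \<open>auto simp: less_imp_le\<close>)

lemma word_map_similarity:
  assumes "\<And>i. i < k \<Longrightarrow> j i \<in> {1..N (\<omega> i)}"
  shows "norm (word_map f \<omega> j k x - word_map f \<omega> j k y) = radius \<omega> k * norm (x - y)"
  using assms
proof (induction k arbitrary: x y)
  case 0
  then show ?case by (simp add: radius_def)
next
  case (Suc k)
  have "norm (f (\<omega> k) (j k) x - f (\<omega> k) (j k) y) = c (\<omega> k) 1 * norm (x - y)"
    using Suc.prems[of k] similarity[OF \<omega>, of "j k" k] equal_ratios[OF \<omega>, of "j k" k] by simp
  then show ?case
    using Suc.IH Suc.prems by (simp add: radius_def)
qed

text \<open>Stated for an arbitrary invariant \<open>X\<close> because it is used both for
  \<open>V\<close>, in the disjointness argument, and for \<open>\<Delta>\<close>, in the nesting of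
  levels.\<close>

lemma word_map_image_subset:
  assumes "\<And>i. i < n \<Longrightarrow> j i \<in> {1..N (\<omega> i)}" and "k \<le> n"
    and inv: "\<And>l i. \<lbrakk>l \<in> \<Lambda>; i \<in> {1..N l}\<rbrakk> \<Longrightarrow> f l i ` X \<subseteq> X"
  shows "word_map f \<omega> j n ` X \<subseteq> word_map f \<omega> j k ` X"
  using assms(2,1)
proof (induction rule: dec_induct)
  case (step m)
  have "f (\<omega> m) (j m) ` X \<subseteq> X"
    using step.prems by (intro inv \<omega>) auto
  then have "word_map f \<omega> j (Suc m) ` X \<subseteq> word_map f \<omega> j m ` X"
    by (auto simp flip: image_image)
  then show ?case
    using step by (meson less_SucI order_trans)
qed simp

text \<open>If the words differ before the last letter, the images sit inside sets already disjoint.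
  Otherwise the common prefix map is injective and carries the disjoint pieces of the last step to
  disjoint sets.\<close>

lemma word_map_disjoint:
  assumes "\<And>i. i < k \<Longrightarrow> j i \<in> {1..N (\<omega> i)}" "\<And>i. i < k \<Longrightarrow> j' i \<in> {1..N (\<omega> i)}"
    and "\<exists>i<k. j i \<noteq> j' i"
  shows "word_map f \<omega> j k ` V \<inter> word_map f \<omega> j' k ` V = {}"
  using assms
proof (induction k)
  case (Suc k)
  show ?case
  proof (cases "\<exists>i<k. j i \<noteq> j' i")
    case True
    then have "word_map f \<omega> j k ` V \<inter> word_map f \<omega> j' k ` V = {}"
      using Suc by simp
    moreover have "word_map f \<omega> j (Suc k) ` V \<subseteq> word_map f \<omega> j k ` V"
      "word_map f \<omega> j' (Suc k) ` V \<subseteq> word_map f \<omega> j' k ` V"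
      using Suc.prems by (intro word_map_image_subset V_invariant; simp)+
    ultimately show ?thesis by blast
  next
    case False
    then have eq: "word_map f \<omega> j k = word_map f \<omega> j' k" and "j k \<noteq> j' k"
      using Suc.prems(3) word_map_cong[of k j j'] by (auto simp: less_Suc_eq)
    then have disj: "f (\<omega> k) (j k) ` V \<inter> f (\<omega> k) (j' k) ` V = {}"
      using Suc.prems by (intro V_disjoint \<omega>) auto
    have "inj (word_map f \<omega> j k)"
    proof (rule injI)
      fix x y assume "word_map f \<omega> j k x = word_map f \<omega> j k y"
      then have "radius \<omega> k * norm (x - y) = 0"
        using word_map_similarity[of k j x y] Suc.prems(1) by simp
      then show "x = y" using radius_pos[of k] by simp
    qed
    then have "word_map f \<omega> j k ` (f (\<omega> k) (j k) ` V) \<inter> word_map f \<omega> j k ` (f (\<omega> k) (j' k) ` V) = {}"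
      using disj by (simp flip: image_Int)
    then show ?thesis
      by (simp add: image_comp flip: eq)
  qed
qed simp

text \<open>If the two marker points were closer, surjectivity would make the second one the image,
  under the first word, of a point of the ball around \<open>x0\<close>. That point lies in
  \<open>V\<close>, so the two images of \<open>V\<close> would intersect.\<close>

lemma word_map_separated:
  assumes "\<And>i. i < k \<Longrightarrow> j i \<in> {1..N (\<omega> i)}" "\<And>i. i < k \<Longrightarrow> j' i \<in> {1..N (\<omega> i)}"
    and "\<exists>i<k. j i \<noteq> j' i" and "ball x0 \<rho> \<subseteq> V" and "0 < \<rho>"
  shows "\<rho> * radius \<omega> k \<le> norm (word_map f \<omega> j k x0 - word_map f \<omega> j' k x0)"
proof (rule ccontr)
  assume "\<not> ?thesis"
  then have less: "norm (word_map f \<omega> j k x0 - word_map f \<omega> j' k x0) < \<rho> * radius \<omega> k"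
    by simp
  have "surj (word_map f \<omega> j k)"
    by (rule similarity_surj[OF radius_pos[of k]]) (use assms in \<open>auto intro: word_map_similarity\<close>)
  then obtain z where z: "word_map f \<omega> j' k x0 = word_map f \<omega> j k z"
    using surjD[of "word_map f \<omega> j k" "word_map f \<omega> j' k x0"] by blast
  have "radius \<omega> k * norm (x0 - z) < \<rho> * radius \<omega> k"
    using less unfolding z by (subst (asm) word_map_similarity) (use assms in auto)
  then have "dist x0 z < \<rho>"
    using radius_pos[of k] by (simp add: dist_norm)
  then have "z \<in> V" "x0 \<in> V" using assms by auto
  then have "word_map f \<omega> j k z \<in> word_map f \<omega> j k ` V \<inter> word_map f \<omega> j' k ` V"
    using z by (metis IntI imageI)
  then show False
    using word_map_disjoint[of k j j'] assms by auto
qed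

section \<open>Levels and compactness\<close>

lemma level_antimono:
  assumes "k \<le> n" shows "level \<omega> n \<subseteq> level \<omega> k"
proof
  fix x assume "x \<in> level \<omega> n"
  then obtain w where w: "w \<in> words \<omega> n" "x \<in> word_map f \<omega> w n ` \<Delta>"
    by (auto simp: level_def)
  then have "x \<in> word_map f \<omega> w k ` \<Delta>"
    using word_map_image_subset[of n w k \<Delta>] wordsD[OF w(1)] assms invariant by blast
  also have "word_map f \<omega> w k = word_map f \<omega> (restrict w {..<k}) k"
    by (rule word_map_cong) simp
  finally show "x \<in> level \<omega> k"
    using restrict_words[OF w(1) assms] by (auto simp: level_def)
qed

lemma compact_level: "compact (level \<omega> k)"
  unfolding level_def
proof (rule compact_UN)
  fix w assume w: "w \<in> words \<omega> k"
  have "(radius \<omega> k)-lipschitz_on \<Delta> (word_map f \<omega> w k)"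
    using radius_pos[of k] word_map_similarity[of k w] wordsD[OF w]
    by (intro lipschitz_onI) (auto simp: dist_norm)
  then show "compact (word_map f \<omega> w k ` \<Delta>)"
    by (intro compact_continuous_image compact_invariant lipschitz_on_continuous_on)
qed simp

text \<open>The parts of the levels outside \<open>W\<close> are nested compact sets with empty
  intersection, so one of them is empty.\<close>

lemma level_subset_open:
  assumes "open W" "attractor N f \<Delta> \<omega> \<subseteq> W"
  obtains n where "level \<omega> n \<subseteq> W"
proof -
  \<comment> \<open>The attractor intersects the levels from 1 on, hence the shift.\<close>
  have "\<exists>n. level \<omega> (Suc n) - W = {}"
  proof (rule ccontr)
    assume "\<nexists>n. level \<omega> (Suc n) - W = {}"
    then have "(\<Inter>n. level \<omega> (Suc n) - W) \<noteq> {}"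
    proof (intro compact_nest)
      show "level \<omega> (Suc n) - W \<subseteq> level \<omega> (Suc m) - W" if "m \<le> n" for m n
        using level_antimono[of "Suc m" "Suc n"] that by (simp add: Diff_mono)
    qed (simp_all add: compact_diff compact_level assms(1))
    then obtain x where x: "\<And>n. x \<in> level \<omega> (Suc n)" "x \<notin> W" by auto
    have "x \<in> attractor N f \<Delta> \<omega>"
      unfolding attractor_eq
    proof
      fix k :: nat assume "k \<in> {1..}"
      then show "x \<in> level \<omega> k" using x(1)[of "k - 1"] by simp
    qed
    with x(2) assms(2) show False by auto
  qed
  then show thesis using that by blast
qed

text \<open>A word of length \<open>k\<close> has
  \<open>number \<omega> n / number \<omega> k\<close> extensions of length \<open>n\<close>;
  multiplying out keeps the count in the natural numbers.\<close>

lemma card_extensions_le: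
  assumes "Q \<subseteq> words \<omega> k" "k \<le> n"
  shows "card {w \<in> words \<omega> n. restrict w {..<k} \<in> Q} * number \<omega> k \<le> card Q * number \<omega> n"
proof -
  have finQ: "finite Q" by (rule finite_subset[OF assms(1)]) simp
  let ?T = "PiE {k..<n} (\<lambda>i. {1..N (\<omega> i)})"
  have "card {w \<in> words \<omega> n. restrict w {..<k} \<in> Q} \<le> card (Q \<times> ?T)"
  proof (rule card_inj_on_le)
    let ?g = "\<lambda>w. (restrict w {..<k}, restrict w {k..<n})"
    show "inj_on ?g {w \<in> words \<omega> n. restrict w {..<k} \<in> Q}"
    proof (rule inj_onI)
      fix w w' assume w: "w \<in> {w \<in> words \<omega> n. restrict w {..<k} \<in> Q}"
        "w' \<in> {w \<in> words \<omega> n. restrict w {..<k} \<in> Q}" and eq: "?g w = ?g w'"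
      show "w = w'"
      proof (rule PiE_ext)
        show "w \<in> PiE {..<n} (\<lambda>i. {1..N (\<omega> i)})" "w' \<in> PiE {..<n} (\<lambda>i. {1..N (\<omega> i)})"
          using w by (auto simp: words_def)
        fix i assume "i \<in> {..<n}"
        then show "w i = w' i"
          using eq by (cases "i < k") (auto dest!: fun_cong[of _ _ i])
      qed
    qed
    show "?g ` {w \<in> words \<omega> n. restrict w {..<k} \<in> Q} \<subseteq> Q \<times> ?T"
      by (auto simp: words_def PiE_iff)
    show "finite (Q \<times> ?T)" using finQ by (auto intro!: finite_PiE)
  qed
  also have "\<dots> = card Q * (\<Prod>i\<in>{k..<n}. N (\<omega> i))"
    by (simp add: card_cartesian_product card_PiE)
  finally have "card {w \<in> words \<omega> n. restrict w {..<k} \<in> Q} * number \<omega> k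
      \<le> card Q * ((\<Prod>i\<in>{k..<n}. N (\<omega> i)) * number \<omega> k)"
    by (simp only: mult.assoc[symmetric] mult_right_mono)
  also have "(\<Prod>i\<in>{k..<n}. N (\<omega> i)) * number \<omega> k = number \<omega> n"
  proof -
    have "{..<n} = {..<k} \<union> {k..<n}" using assms(2) by auto
    then show ?thesis
      unfolding number_def by (simp add: prod.union_disjoint mult.commute ivl_disj_int)
  qed
  finally show ?thesis .
qed

end

section \<open>The covering estimate\<close>

text \<open>Each \<open>U i\<close>, slightly enlarged, meets at most \<open>M\<close> cylinders of
  level \<open>k i\<close>. Compactness leaves finitely many \<open>i\<close>, and counting how many
  words of one deep level each of them accounts for gives the bound. \<open>M\<close> depends on the
  system only, not on \<open>\<omega>\<close> or the cover.\<close>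

lemma cover_bound:
  "\<exists>M>0. \<forall>\<omega> U k. range \<omega> \<subseteq> \<Lambda> \<longrightarrow> attractor N f \<Delta> \<omega> \<subseteq> (\<Union>i. U i) \<longrightarrow>
    (\<forall>i::nat. bounded (U i) \<and> c_min * diameter (U i) \<le> radius \<omega> (k i)) \<longrightarrow>
    (\<exists>I. finite I \<and> 1 \<le> real M * (\<Sum>i\<in>I. 1 / real (number \<omega> (k i))))"
proof -
  obtain x0 where "x0 \<in> V" using V_nonempty by auto
  then obtain \<rho> where \<rho>: "0 < \<rho>" "ball x0 \<rho> \<subseteq> V"
    using open_V open_contains_ball by blast
  obtain z0 where z0: "z0 \<in> \<Delta>" using invariant_nonempty by auto
  have "bounded \<Delta>" using compact_invariant by (rule compact_imp_bounded)
  then obtain D where D: "\<And>y. y \<in> \<Delta> \<Longrightarrow> norm (x0 - y) \<le> D"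
    by (metis bounded_any_center[of \<Delta> x0] dist_norm)
  \<comment> \<open>In units of the radius, the summands account for the distance from the marker
    \<open>x0\<close> to a point of \<open>\<Delta>\<close>, the enlargement of \<open>U i\<close>,
    and the diameter of \<open>U i\<close>.\<close>
  define R where "R = D + 1 + 1 / c_min"
  from separated_card_le[OF \<rho>(1), of R]
  obtain M :: nat where M: "0 < M" and "\<forall>r>0. \<forall>(x::real^'d) p Q.
    (\<forall>w\<in>Q. norm (p w - x) \<le> R * r) \<longrightarrow> (\<forall>w\<in>Q. \<forall>w'\<in>Q. w \<noteq> w' \<longrightarrow> \<rho> * r \<le> norm (p w - p w'))
    \<longrightarrow> card (Q :: (nat \<Rightarrow> nat) set) \<le> M"
    by (elim exE conjE)
  note packing = this(2)[rule_format]
  show ?thesis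
  proof (intro exI[of _ M] conjI allI impI M)
    fix \<omega> U and k :: "nat \<Rightarrow> nat"
    assume \<omega>: "range \<omega> \<subseteq> \<Lambda>" and cov: "attractor N f \<Delta> \<omega> \<subseteq> (\<Union>i. U i)"
      and U: "\<forall>i::nat. bounded (U i) \<and> c_min * diameter (U i) \<le> radius \<omega> (k i)"
    then have bdd: "bounded (U i)" and diam: "c_min * diameter (U i) \<le> radius \<omega> (k i)" for i
      by auto
    \<comment> \<open>Enlarging by the radius of its own level makes the cover open while keeping
      its members of comparable size.\<close>
    define G where "G i = (\<Union>x\<in>U i. ball x (radius \<omega> (k i)))" for i
    define Q where "Q i = {w \<in> words \<omega> (k i). word_map f \<omega> w (k i) ` \<Delta> \<inter> G i \<noteq> {}}" for i
    have cardQ: "card (Q i) \<le> M" for i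
    proof (cases "Q i = {}")
      case False
      then obtain u where u: "u \<in> U i" by (auto simp: Q_def G_def)
      have r: "0 < radius \<omega> (k i)" using radius_pos[OF \<omega>] .
      show ?thesis
      proof (rule packing[OF r, of _ "\<lambda>w. word_map f \<omega> w (k i) x0" u])
        fix w assume w: "w \<in> Q i"
        then obtain y x where y: "y \<in> \<Delta>" and x: "x \<in> U i" "dist x (word_map f \<omega> w (k i) y) < radius \<omega> (k i)"
          by (auto simp: Q_def G_def)
        have "norm (word_map f \<omega> w (k i) x0 - word_map f \<omega> w (k i) y) = radius \<omega> (k i) * norm (x0 - y)"
          by (rule word_map_similarity[OF \<omega>]) (use w in \<open>auto simp: Q_def dest: wordsD\<close>)
        also have "\<dots> \<le> radius \<omega> (k i) * D"
          using D[OF y] r by simp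
        finally have 1: "dist (word_map f \<omega> w (k i) x0) (word_map f \<omega> w (k i) y) \<le> radius \<omega> (k i) * D"
          by (simp add: dist_norm)
        have "dist x u \<le> diameter (U i)"
          using bdd x(1) u by (rule diameter_bounded_bound)
        also have "\<dots> \<le> radius \<omega> (k i) / c_min"
          using diam[of i] c_min_pos by (simp add: field_simps)
        finally have 2: "dist x u \<le> radius \<omega> (k i) / c_min" .
        have "dist (word_map f \<omega> w (k i) x0) u \<le> dist (word_map f \<omega> w (k i) x0) (word_map f \<omega> w (k i) y)
            + dist x (word_map f \<omega> w (k i) y) + dist x u"
          by metric
        also have "\<dots> \<le> radius \<omega> (k i) * D + radius \<omega> (k i) + radius \<omega> (k i) / c_min"
          using 1 2 x(2) by linarith
        also have "\<dots> = R * radius \<omega> (k i)" by (simp add: R_def algebra_simps)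
        finally show "norm (word_map f \<omega> w (k i) x0 - u) \<le> R * radius \<omega> (k i)"
          by (simp add: dist_norm)
      next
        fix w w' assume w: "w \<in> Q i" "w' \<in> Q i" "w \<noteq> w'"
        have "\<exists>n<k i. w n \<noteq> w' n"
        proof (rule ccontr)
          assume "\<not> ?thesis"
          then have "w = w'"
            using w unfolding Q_def words_def by (intro PiE_ext[of w "{..<k i}"]) auto
          with w show False by simp
        qed
        then show "\<rho> * radius \<omega> (k i) \<le> norm (word_map f \<omega> w (k i) x0 - word_map f \<omega> w' (k i) x0)"
          using w \<rho> by (intro word_map_separated[OF \<omega>]) (auto simp: Q_def dest: wordsD)
      qed
    qed simp
    have opn: "open (\<Union>i. G i)" by (auto simp: G_def)
    have UG: "U i \<subseteq> G i" for i
    proof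
      fix x assume "x \<in> U i"
      moreover have "x \<in> ball x (radius \<omega> (k i))"
        using radius_pos[OF \<omega>] by simp
      ultimately show "x \<in> G i" unfolding G_def by (rule UN_I)
    qed
    have "attractor N f \<Delta> \<omega> \<subseteq> (\<Union>i. G i)"
      by (rule order_trans[OF cov UN_mono]) (use UG in auto)
    from level_subset_open[OF \<omega> opn this]
    obtain n0 where n0: "level \<omega> n0 \<subseteq> (\<Union>i. G i)" .
    obtain I where I: "finite I" "level \<omega> n0 \<subseteq> (\<Union>i\<in>I. G i)"
    proof (rule compactE_image[OF compact_level[OF \<omega>, of n0], of UNIV G])
      show "open (G i)" for i by (auto simp: G_def)
    qed (use n0 in auto)
    \<comment> \<open>One level at least as deep as \<open>n0\<close> and as every
      \<open>k i\<close> in use; inserting \<open>n0\<close> keeps the maximum meaningful for empty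
      \<open>I\<close>.\<close>
    define n where "n = Max (insert n0 (k ` I))"
    have n: "n0 \<le> n" "\<And>i. i \<in> I \<Longrightarrow> k i \<le> n"
      using I(1) by (auto simp: n_def)
    define E where "E i = {w \<in> words \<omega> n. restrict w {..<k i} \<in> Q i}" for i
    have "words \<omega> n \<subseteq> (\<Union>i\<in>I. E i)"
    proof
      fix w assume w: "w \<in> words \<omega> n"
      \<comment> \<open>One point of the cylinder suffices: whichever \<open>G i\<close> contains it
        meets the larger cylinder of the prefix of length \<open>k i\<close>, so that prefix belongs
        to \<open>Q i\<close>.\<close>
      define x where "x = word_map f \<omega> w n z0"
      have x: "x \<in> word_map f \<omega> w n ` \<Delta>" using z0 by (simp add: x_def)
      then have "x \<in> level \<omega> n" using w by (auto simp: level_def)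
      then have "x \<in> level \<omega> n0" using level_antimono[OF \<omega> n(1)] by auto
      then obtain i where i: "i \<in> I" "x \<in> G i" using I(2) by auto
      have "x \<in> word_map f \<omega> w (k i) ` \<Delta>"
        using word_map_image_subset[OF \<omega>, of n w "k i" \<Delta>] wordsD[OF w] n(2)[OF i(1)] invariant x by blast
      also have "word_map f \<omega> w (k i) = word_map f \<omega> (restrict w {..<k i}) (k i)"
        by (rule word_map_cong) simp
      finally have "restrict w {..<k i} \<in> Q i"
        using i(2) restrict_words[OF w n(2)[OF i(1)]] unfolding Q_def by blast
      then show "w \<in> (\<Union>i\<in>I. E i)" using w i(1) by (auto simp: E_def)
    qed
    then have "card (words \<omega> n) \<le> card (\<Union>i\<in>I. E i)"
      using I(1) by (intro card_mono) (auto simp: E_def)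
    also have "\<dots> \<le> (\<Sum>i\<in>I. card (E i))"
      by (rule card_UN_le[OF I(1)])
    finally have "real (number \<omega> n) \<le> (\<Sum>i\<in>I. real (card (E i)))"
      unfolding card_words by (metis of_nat_le_iff of_nat_sum)
    also have "\<dots> \<le> (\<Sum>i\<in>I. real M * (1 / real (number \<omega> (k i))) * real (number \<omega> n))"
    proof (rule sum_mono)
      fix i assume i: "i \<in> I"
      have "card (E i) * number \<omega> (k i) \<le> card (Q i) * number \<omega> n"
        unfolding E_def by (rule card_extensions_le[OF \<omega>]) (use n(2)[OF i] in \<open>auto simp: Q_def\<close>)
      also have "\<dots> \<le> M * number \<omega> n" using cardQ by simp
      finally have "real (card (E i)) * real (number \<omega> (k i)) \<le> real M * real (number \<omega> n)"
        by (metis of_nat_le_iff of_nat_mult)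
      then show "real (card (E i)) \<le> real M * (1 / real (number \<omega> (k i))) * real (number \<omega> n)"
        using number_pos[OF \<omega>, of "k i"] by (simp add: field_simps)
    qed
    also have "\<dots> = real M * (\<Sum>i\<in>I. 1 / real (number \<omega> (k i))) * real (number \<omega> n)"
      by (simp only: sum_distrib_left sum_distrib_right)
    finally have "1 \<le> real M * (\<Sum>i\<in>I. 1 / real (number \<omega> (k i)))"
      using number_pos[OF \<omega>, of n] by simp
    then show "\<exists>I. finite I \<and> 1 \<le> real M * (\<Sum>i\<in>I. 1 / real (number \<omega> (k i)))"
      using I(1) by blast
  qed
qed

end

subsection \<open>Hausdorff measure of the attractor\<close>

context homogeneous_rifs
begin

text \<open>A covering set of positive diameter is assigned the first level whose radius does not
  exceed the diameter, where \<open>h\<close> dominates \<open>K / number\<close>. Sets of diameter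
  0 are assigned levels so deep that they contribute little to the covering estimate.\<close>

lemma hausdorff_measure_attractor_infinite:
  assumes \<omega>: "range \<omega> \<subseteq> \<Lambda>"
    and number: "filterlim (\<lambda>k. real (number \<omega> k)) at_top sequentially"
    and h: "\<And>K::real. 0 < K \<Longrightarrow> eventually (\<lambda>k. \<forall>d. radius \<omega> (Suc k) \<le> d \<and> d < radius \<omega> k \<longrightarrow>
      K / real (number \<omega> (Suc k)) \<le> h d) sequentially"
  shows "hausdorff_measure h (attractor N f \<Delta> \<omega>) = \<infinity>"
proof -
  from cover_bound obtain M :: nat where M: "0 < M" and "\<forall>\<omega> U k. range \<omega> \<subseteq> \<Lambda> \<longrightarrow>
    attractor N f \<Delta> \<omega> \<subseteq> (\<Union>i. U i) \<longrightarrow>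
    (\<forall>i::nat. bounded (U i) \<and> c_min * diameter (U i) \<le> radius \<omega> (k i)) \<longrightarrow>
    (\<exists>I. finite I \<and> 1 \<le> real M * (\<Sum>i\<in>I. 1 / real (number \<omega> (k i))))"
    by (elim exE conjE)
  note cover = this(2)[rule_format, OF \<omega>]
  have lower: "ennreal K \<le> hausdorff_measure h (attractor N f \<Delta> \<omega>)" if K: "0 < K" for K :: real
  proof -
    \<comment> \<open>\<open>M\<close> cancels the constant of the covering estimate; the 2
      compensates for the half conceded to the error terms.\<close>
    define K' where "K' = 2 * real M * K"
    have K': "0 < K'" using K M by (simp add: K'_def)
    from h[OF K'] obtain k0 where k0: "\<And>k d. \<lbrakk>k0 \<le> k; radius \<omega> (Suc k) \<le> d; d < radius \<omega> k\<rbrakk> \<Longrightarrow>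
      K' / real (number \<omega> (Suc k)) \<le> h d"
      unfolding eventually_sequentially by blast
    define \<delta> where "\<delta> = radius \<omega> k0 / 2"
    have \<delta>: "0 < \<delta>" "\<delta> < radius \<omega> k0" using radius_pos[OF \<omega>, of k0] by (auto simp: \<delta>_def)
    have "ennreal K \<le> (\<Sum>i. ennreal (h (diameter (U i))))"
      if U: "U \<in> delta_covers \<delta> (attractor N f \<Delta> \<omega>)" for U
    proof -
      define d where "d i = diameter (U i)" for i
      have bdd: "bounded (U i)" and d\<delta>: "d i \<le> \<delta>" for i
        using U by (auto simp: delta_covers_def d_def)
      have d_nonneg: "0 \<le> d i" for i using bdd by (simp add: d_def diameter_ge_0)
      \<comment> \<open>The errors \<open>(1/2) ^ (i + 2)\<close> add up to \<open>1/2\<close>. The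
        truncation \<open>max 0\<close> matches the one made by \<open>ennreal\<close>.\<close>
      have "\<exists>k. c_min * d i \<le> radius \<omega> k \<and>
        real M / real (number \<omega> k) \<le> real M / K' * max 0 (h (d i)) + (1/2) ^ (i + 2)" for i
      proof (cases "d i = 0")
        case True
        have "eventually (\<lambda>k. real M / (1/2) ^ (i + 2) \<le> real (number \<omega> k)) sequentially"
          using number by (simp add: filterlim_at_top)
        then obtain k where k: "real M / (1/2) ^ (i + 2) \<le> real (number \<omega> k)"
          by (auto simp: eventually_sequentially)
        have "real M / real (number \<omega> k) \<le> (1/2) ^ (i + 2)"
          using k number_pos[OF \<omega>, of k] by (simp add: field_simps)
        moreover have "0 \<le> real M / K' * max 0 (h (d i))"
          using K' by simp
        ultimately have "real M / real (number \<omega> k) \<le> real M / K' * max 0 (h (d i)) + (1/2) ^ (i + 2)"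
          by linarith
        then show ?thesis
          using True radius_pos[OF \<omega>, of k] by (intro exI[of _ k]) simp
      next
        case False
        with d_nonneg[of i] have pos: "0 < d i" by simp
        have "eventually (\<lambda>k. radius \<omega> k < d i) sequentially"
          using order_tendstoD(2)[OF radius_tendsto_0[OF \<omega>] pos] .
        then obtain k1 where k1: "radius \<omega> k1 \<le> d i"
          by (auto simp: eventually_sequentially intro: less_imp_le)
        \<comment> \<open>By minimality the diameter lies between the radii of levels
          \<open>k\<close> and \<open>k - 1\<close>; the choice of \<open>\<delta>\<close> forces
          \<open>k > k0\<close>.\<close>
        define k where "k = (LEAST k. radius \<omega> k \<le> d i)"
        have k: "radius \<omega> k \<le> d i" unfolding k_def by (rule LeastI[of _ k1]) (rule k1)
        have "k0 < k"
        proof (rule ccontr)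
          assume "\<not> k0 < k"
          then have "radius \<omega> k0 \<le> radius \<omega> k" by (intro radius_mono[OF \<omega>]) simp
          then show False using k d\<delta>[of i] \<delta> by simp
        qed
        then obtain j where j: "k = Suc j" "k0 \<le> j" by (cases k) auto
        have "\<not> radius \<omega> j \<le> d i" using not_less_Least[of j "\<lambda>k. radius \<omega> k \<le> d i"] j(1) unfolding k_def by auto
        then have dj: "d i < radius \<omega> j" by simp
        have "K' / real (number \<omega> k) \<le> h (d i)"
          unfolding j(1) by (rule k0[OF j(2) _ dj]) (use k j in simp)
        then have "real M / K' * (K' / real (number \<omega> k)) \<le> real M / K' * max 0 (h (d i))"
          using K' by (intro mult_left_mono) auto
        then have "real M / real (number \<omega> k) \<le> real M / K' * max 0 (h (d i))"
          using K' by simp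
        moreover have "(0::real) \<le> (1/2) ^ (i + 2)" by simp
        ultimately have "real M / real (number \<omega> k) \<le> real M / K' * max 0 (h (d i)) + (1/2) ^ (i + 2)"
          by linarith
        moreover have "c_min * d i \<le> radius \<omega> k"
        proof -
          have "c_min * d i \<le> c_min * radius \<omega> j" using dj c_min_pos by simp
          also have "\<dots> \<le> radius \<omega> k" unfolding j(1) by (rule radius_Suc_ge[OF \<omega>])
          finally show ?thesis .
        qed
        ultimately show ?thesis by blast
      qed
      then obtain k where k: "\<And>i. c_min * d i \<le> radius \<omega> (k i)"
        "\<And>i. real M / real (number \<omega> (k i)) \<le> real M / K' * max 0 (h (d i)) + (1/2) ^ (i + 2)"
        by metis
      have "attractor N f \<Delta> \<omega> \<subseteq> (\<Union>i. U i)" using U by (simp add: delta_covers_def)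
      then have "\<exists>I. finite I \<and> 1 \<le> real M * (\<Sum>i\<in>I. 1 / real (number \<omega> (k i)))"
        by (rule cover) (use bdd k(1) in \<open>simp add: d_def\<close>)
      then obtain I where I: "finite I" and "1 \<le> real M * (\<Sum>i\<in>I. 1 / real (number \<omega> (k i)))"
        by blast
      then have "1 \<le> (\<Sum>i\<in>I. real M / real (number \<omega> (k i)))"
        by (simp add: sum_distrib_left)
      also have "\<dots> \<le> (\<Sum>i\<in>I. real M / K' * max 0 (h (d i)) + (1/2) ^ (i + 2))"
        by (intro sum_mono k(2))
      also have "\<dots> = real M / K' * (\<Sum>i\<in>I. max 0 (h (d i))) + (\<Sum>i\<in>I. (1/2) ^ (i + 2))"
        by (simp add: sum.distrib sum_distrib_left)
      also have "(\<Sum>i\<in>I. (1/2) ^ (i + 2)) \<le> (1/2 :: real)"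
      proof -
        have "(\<lambda>i. (1/2)^2 * (1/2 :: real) ^ i) sums ((1/2)^2 * 2)"
          using geometric_sums[of "1/2::real"] by (intro sums_mult) simp
        then have sums: "(\<lambda>i. (1/2 :: real) ^ (i + 2)) sums (1/2)"
          by (simp add: power_add power2_eq_square mult.commute)
        then have "(\<Sum>i\<in>I. (1/2 :: real) ^ (i + 2)) \<le> (\<Sum>i. (1/2) ^ (i + 2))"
          using I by (intro sum_le_suminf) (auto simp: sums_iff)
        then show ?thesis using sums by (simp add: sums_iff)
      qed
      finally have "1/2 \<le> real M / K' * (\<Sum>i\<in>I. max 0 (h (d i)))" by linarith
      then have "K \<le> (\<Sum>i\<in>I. max 0 (h (d i)))"
        using M K by (simp add: K'_def field_simps)
      then have "ennreal K \<le> ennreal (\<Sum>i\<in>I. max 0 (h (d i)))" by (rule ennreal_leI)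
      also have "\<dots> = (\<Sum>i\<in>I. ennreal (max 0 (h (d i))))" by (rule sum_ennreal[symmetric]) simp
      also have "\<dots> = (\<Sum>i\<in>I. ennreal (h (d i)))" by (simp add: ennreal_max_0)
      also have "\<dots> \<le> (\<Sum>i. ennreal (h (d i)))"
        using I by (intro sum_le_suminf) auto
      finally show ?thesis by (simp add: d_def)
    qed
    then have "ennreal K \<le> hausdorff_premeasure h \<delta> (attractor N f \<Delta> \<omega>)"
      unfolding hausdorff_premeasure_def by (rule INF_greatest)
    also have "\<dots> \<le> hausdorff_measure h (attractor N f \<Delta> \<omega>)"
      unfolding hausdorff_measure_eq_SUP using \<delta>(1) by (intro SUP_upper) simp
    finally show ?thesis .
  qed
  show ?thesis
  proof (rule ccontr)
    assume "hausdorff_measure h (attractor N f \<Delta> \<omega>) \<noteq> \<infinity>"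
    then obtain r where r: "0 \<le> r" "hausdorff_measure h (attractor N f \<Delta> \<omega>) = ennreal r"
      by (cases "hausdorff_measure h (attractor N f \<Delta> \<omega>)") auto
    have "ennreal (r + 1) \<le> ennreal r" using lower[of "r + 1"] r by simp
    then show False using r(1) by (simp add: ennreal_le_iff)
  qed
qed

text \<open>The cylinders of level \<open>k\<close> form a cover by \<open>number \<omega> k\<close>
  sets of diameter at most \<open>radius \<omega> k * D\<close>.\<close>

lemma hausdorff_measure_attractor_zero:
  assumes \<omega>: "range \<omega> \<subseteq> \<Lambda>" and t: "0 < t"
    and lim: "(\<lambda>k. real (number \<omega> k) * radius \<omega> k powr t) \<longlonglongrightarrow> 0"
  shows "hausdorff_measure (\<lambda>x. x powr t) (attractor N f \<Delta> \<omega>) = 0"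
proof -
  have bdd\<Delta>: "bounded \<Delta>" using compact_invariant by (rule compact_imp_bounded)
  define D where "D = diameter \<Delta>"
  have D: "0 \<le> D" using bdd\<Delta> by (simp add: D_def diameter_ge_0)
  have "hausdorff_premeasure (\<lambda>x. x powr t) \<delta> (attractor N f \<Delta> \<omega>) = 0" if \<delta>: "0 < \<delta>" for \<delta>
  proof -
    have bound: "hausdorff_premeasure (\<lambda>x. x powr t) \<delta> (attractor N f \<Delta> \<omega>)
      \<le> ennreal (D powr t * (real (number \<omega> k) * radius \<omega> k powr t))"
      if k: "1 \<le> k" "radius \<omega> k * D \<le> \<delta>" for k
    proof -
      obtain e where e: "bij_betw e {..<number \<omega> k} (words \<omega> k)"
        using ex_bij_betw_nat_finite[of "words \<omega> k"] by (auto simp: card_words atLeast0LessThan)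
      \<comment> \<open>Padding with empty sets costs nothing, as their diameter is 0 and
        \<open>0 powr t = 0\<close>.\<close>
      define U where "U i = (if i < number \<omega> k then word_map f \<omega> (e i) k ` \<Delta> else {})" for i
      have w: "e i \<in> words \<omega> k" if "i < number \<omega> k" for i
        using e that by (auto simp: bij_betw_def)
      have bddU: "bounded (U i)" for i
      proof (cases "i < number \<omega> k")
        case True
        have "U i \<subseteq> level \<omega> k" using True w[OF True] by (auto simp: U_def level_def)
        then show ?thesis
          using compact_imp_bounded[OF compact_level[OF \<omega>]] bounded_subset by blast
      qed (simp add: U_def)
      have diamU: "diameter (U i) \<le> radius \<omega> k * D" for i
      proof (cases "i < number \<omega> k")
        case True
        show ?thesis
        proof (rule diameter_le)
          show "U i \<noteq> {} \<or> 0 \<le> radius \<omega> k * D" using D radius_pos[OF \<omega>, of k] by simp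
          fix x y assume "x \<in> U i" "y \<in> U i"
          then obtain a b where ab: "a \<in> \<Delta>" "b \<in> \<Delta>" "x = word_map f \<omega> (e i) k a" "y = word_map f \<omega> (e i) k b"
            using True by (auto simp: U_def)
          have "norm (x - y) = radius \<omega> k * norm (a - b)"
            unfolding ab by (rule word_map_similarity[OF \<omega>]) (rule wordsD[OF w[OF True]])
          also have "norm (a - b) \<le> D"
            using diameter_bounded_bound[OF bdd\<Delta> ab(1,2)] by (simp add: D_def dist_norm)
          finally show "norm (x - y) \<le> radius \<omega> k * D"
            using radius_pos[OF \<omega>, of k] by simp
        qed
      qed (use D radius_pos[OF \<omega>, of k] in \<open>simp add: U_def\<close>)
      have "attractor N f \<Delta> \<omega> \<subseteq> level \<omega> k"
        unfolding attractor_eq using k(1) by (intro INF_lower) simp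
      also have "\<dots> \<subseteq> (\<Union>i. U i)"
      proof
        fix x assume "x \<in> level \<omega> k"
        then obtain v where v: "v \<in> words \<omega> k" "x \<in> word_map f \<omega> v k ` \<Delta>" by (auto simp: level_def)
        then obtain i where "i < number \<omega> k" "v = e i"
          using e by (auto simp: bij_betw_def)
        then show "x \<in> (\<Union>i. U i)" using v by (auto simp: U_def)
      qed
      finally have "U \<in> delta_covers \<delta> (attractor N f \<Delta> \<omega>)"
        using bddU order_trans[OF diamU k(2)] by (simp add: delta_covers_def)
      then have "hausdorff_premeasure (\<lambda>x. x powr t) \<delta> (attractor N f \<Delta> \<omega>)
        \<le> (\<Sum>i. ennreal (diameter (U i) powr t))"
        unfolding hausdorff_premeasure_def by (rule INF_lower)
      also have "\<dots> = (\<Sum>i<number \<omega> k. ennreal (diameter (U i) powr t))"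
        by (rule suminf_finite) (auto simp: U_def diameter_def)
      also have "\<dots> \<le> (\<Sum>i<number \<omega> k. ennreal ((radius \<omega> k * D) powr t))"
        using diamU bddU t by (intro sum_mono ennreal_leI powr_mono2) (auto simp: diameter_ge_0)
      also have "\<dots> = ennreal (D powr t * (real (number \<omega> k) * radius \<omega> k powr t))"
        using D radius_pos[OF \<omega>, of k]
        by (simp add: powr_mult ennreal_of_nat_eq_real_of_nat mult_ac flip: ennreal_mult)
      finally show ?thesis .
    qed
    have "eventually (\<lambda>k. radius \<omega> k * D < \<delta>) sequentially"
      using tendsto_mult_right[OF radius_tendsto_0[OF \<omega>], of D] \<delta> by (intro order_tendstoD(2)) auto
    then have "eventually (\<lambda>k. hausdorff_premeasure (\<lambda>x. x powr t) \<delta> (attractor N f \<Delta> \<omega>)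
      \<le> ennreal (D powr t * (real (number \<omega> k) * radius \<omega> k powr t))) sequentially"
      using eventually_ge_at_top[of 1] by eventually_elim (simp add: bound)
    moreover have "(\<lambda>k. ennreal (D powr t * (real (number \<omega> k) * radius \<omega> k powr t))) \<longlonglongrightarrow> ennreal (D powr t * 0)"
      by (intro tendsto_ennrealI tendsto_mult_left lim)
    ultimately have "hausdorff_premeasure (\<lambda>x. x powr t) \<delta> (attractor N f \<Delta> \<omega>) \<le> ennreal (D powr t * 0)"
      by (intro tendsto_lowerbound) auto
    then show ?thesis by simp
  qed
  then show ?thesis
    unfolding hausdorff_measure_eq_SUP by (intro antisym SUP_least) simp_all
qed

end

subsection \<open>The gauge function\<close>

lemma ln_one_div_powr: "0 < (t::real) \<Longrightarrow> ln (1 / t powr \<beta>) = \<beta> * ln (1 / t)"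
  by (simp add: ln_div algebra_simps)

text \<open>In the variable \<open>u = \<beta> * ln (1 / t)\<close> the root becomes
  \<open>sqrt (2 * u * ln (ln u))\<close>, the form used in all estimates of the gauge.\<close>

lemma h1_eq:
  assumes "0 < t"
  shows "h1 s \<beta> \<gamma> t = t powr s * exp ((1 - \<gamma>) * sqrt (2 * (\<beta> * ln (1 / t)) * ln (ln (\<beta> * ln (1 / t)))))"
  unfolding h1_def ln_one_div_powr[OF assms] by (simp add: powr_def mult_ac)

text \<open>The derivative of \<open>sqrt (2 * u * ln (ln u))\<close> tends to 0, so the linear term
  eventually decides the sign of the derivative. Starting beyond \<open>exp 1\<close> keeps
  \<open>ln (ln u)\<close> positive.\<close>

lemma sqrt_log_log_eventually_dominated:
  assumes "0 < (a::real)"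
  obtains u0 where "exp 1 < u0"
    "\<And>u v. \<lbrakk>u0 \<le> u; u \<le> v\<rbrakk> \<Longrightarrow> b * sqrt (2 * v * ln (ln v)) - a * v \<le> b * sqrt (2 * u * ln (ln u)) - a * u"
proof -
  \<comment> \<open>The derivative of \<open>sqrt (2 * u * ln (ln u))\<close>, in the shape the
    chain rule produces.\<close>
  define G' where "G' u = (2 * ln (ln u) + 2 * u * (1 / u / ln u)) * (inverse (sqrt (2 * u * ln (ln u))) / 2)" for u :: real
  have "(G' \<longlongrightarrow> 0) at_top"
    unfolding G'_def by real_asymp
  then have "((\<lambda>u. b * G' u - a) \<longlongrightarrow> b * 0 - a) at_top"
    by (intro tendsto_intros)
  then have "eventually (\<lambda>u. b * G' u - a < 0) at_top"
    using assms by (intro order_tendstoD(2)) auto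
  then obtain u1 where u1: "\<And>u. u1 \<le> u \<Longrightarrow> b * G' u - a < 0"
    by (auto simp: eventually_at_top_linorder)
  define u0 where "u0 = max u1 (exp 1 + 1)"
  show thesis
  proof (rule that[of u0])
    show "exp 1 < u0" by (simp add: u0_def)
    fix u v assume uv: "u0 \<le> u" "u \<le> v"
    show "b * sqrt (2 * v * ln (ln v)) - a * v \<le> b * sqrt (2 * u * ln (ln u)) - a * u"
    proof (rule DERIV_nonpos_imp_nonincreasing[OF uv(2)])
      fix x assume x: "u \<le> x" "x \<le> v"
      then have xe: "exp 1 < x" using uv(1) by (simp add: u0_def)
      then have x0: "0 < x" using exp_gt_zero less_trans by blast
      have lnx: "1 < ln x" using ln_less_cancel_iff[of "exp 1" x] xe x0 by simp
      have lnlnx: "0 < ln (ln x)" using lnx by simp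
      have "1 < x" using xe exp_ge_add_one_self[of 1] by linarith
      have "((\<lambda>x. b * sqrt (2 * x * ln (ln x)) - a * x) has_real_derivative b * G' x - a) (at x)"
        unfolding G'_def using x0 lnx lnlnx \<open>1 < x\<close>
        by (auto intro!: derivative_eq_intros simp: field_simps mult_less_0_iff)
      then show "\<exists>y. ((\<lambda>x. b * sqrt (2 * x * ln (ln x)) - a * x) has_real_derivative y) (at x) \<and> y \<le> 0"
        using u1[of x] uv(1) x by (auto simp: u0_def intro: less_imp_le)
    qed
  qed
qed

text \<open>As a function of \<open>u = \<beta> * ln (1 / t)\<close> the gauge is the exponential of
  an eventually decreasing function, and \<open>u\<close> decreases in \<open>t\<close>.\<close>

lemma h1_gauge_on_exists:
  assumes s: "0 < s" and \<beta>: "0 < \<beta>"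
  shows "\<exists>r. h1_gauge_on s \<beta> \<gamma> r"
proof -
  have "0 < s / \<beta>" using s \<beta> by simp
  then obtain u0 where u0: "exp 1 < u0" and dec: "\<And>u v. \<lbrakk>u0 \<le> u; u \<le> v\<rbrakk> \<Longrightarrow>
    (1 - \<gamma>) * sqrt (2 * v * ln (ln v)) - s / \<beta> * v \<le> (1 - \<gamma>) * sqrt (2 * u * ln (ln u)) - s / \<beta> * u"
    using sqrt_log_log_eventually_dominated[of "s / \<beta>" "1 - \<gamma>"] by metis
  \<comment> \<open>The point at which \<open>\<beta> * ln (1 / r) = u0\<close>.\<close>
  define r where "r = exp (- u0 / \<beta>)"
  define u where "u t = \<beta> * ln (1 / t)" for t
  have u_ge: "u0 \<le> u t" if "0 < t" "t \<le> r" for t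
  proof -
    have "ln t \<le> - u0 / \<beta>"
      using that ln_le_cancel_iff[of t "exp (- u0 / \<beta>)"] unfolding r_def by simp
    then show ?thesis using \<beta> that by (simp add: u_def ln_div field_simps)
  qed
  have h1: "h1 s \<beta> \<gamma> t = exp ((1 - \<gamma>) * sqrt (2 * u t * ln (ln (u t))) - s / \<beta> * u t)" if "0 < t" for t
  proof -
    have "t powr s = exp (- (s / \<beta> * u t))"
      using that \<beta> by (simp add: powr_def u_def ln_div)
    then show ?thesis
      unfolding h1_eq[OF that] u_def[symmetric] by (simp flip: exp_add)
  qed
  have "h1_gauge_on s \<beta> \<gamma> r"
    unfolding h1_gauge_on_def
  proof (intro conjI ballI mono_onI)
    fix t assume "t \<in> {0<..r}"
    then have t: "0 < t" "t \<le> r" by auto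
    have u: "exp 1 < u t" using u_ge[OF t] u0 by simp
    have u_pos: "0 < u t" using u exp_gt_zero less_trans by blast
    have "1 < u t" using u exp_ge_add_one_self[of 1] by linarith
    have lnu: "1 < ln (u t)" using ln_less_cancel_iff[of "exp 1" "u t"] u u_pos by simp
    show "0 < ln (1 / t powr \<beta>)" "0 < ln (ln (1 / t powr \<beta>))"
      unfolding ln_one_div_powr[OF t(1)] u_def[symmetric] using u_pos lnu \<open>1 < u t\<close> by auto
    show "0 \<le> 2 * \<beta> * ln (1 / t) * ln (ln (ln (1 / t powr \<beta>)))"
      unfolding ln_one_div_powr[OF t(1)]
      using mult_nonneg_nonneg[of "u t" "ln (ln (u t))"] u_pos lnu by (simp add: u_def mult.assoc)
  next
    fix x y assume "x \<in> {0<..r}" "y \<in> {0<..r}" "x \<le> y"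
    then have xy: "0 < x" "x \<le> y" "y \<le> r" by auto
    have "u y \<le> u x" using xy \<beta> by (simp add: u_def ln_div)
    then show "h1 s \<beta> \<gamma> x \<le> h1 s \<beta> \<gamma> y"
      using xy dec[OF u_ge[of y], of "u x"] by (simp add: h1)
  qed (simp add: r_def)
  then show ?thesis ..
qed

text \<open>The choice of \<open>\<beta>\<close> gives
  \<open>\<beta> * ln (1 / d) \<ge> (C + 1)\<^sup>2 * k\<close>, so the root in the gauge is at
  least \<open>C + 1\<close> times \<open>sqrt (2 * k * ln (ln k))\<close>: \<open>C\<close> of
  these beat the fluctuation and one absorbs \<open>K\<close>. The outer exponent
  \<open>1 + \<epsilon>\<close> only helps.\<close>

lemma h1_eventually_ge:
  assumes C: "0 \<le> C" and q: "0 < q" and \<epsilon>: "0 \<le> \<epsilon>" and K: "0 < K" and \<beta>: "\<beta> = (C + 1)\<^sup>2 / q"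
  shows "eventually (\<lambda>k. \<forall>d. 0 < d \<and> q * real k \<le> ln (1 / d) \<longrightarrow>
    K * exp (C * sqrt (real (Suc k) * ln (ln (real (Suc k))))) * d powr s \<le> h1 s \<beta> (- \<epsilon>) d) sequentially"
proof -
  \<comment> \<open>The factor 2 under the root pays for the passage from \<open>k\<close> to
    \<open>Suc k\<close>.\<close>
  have "eventually (\<lambda>k::nat. ln (real k) > 1) sequentially"
    "eventually (\<lambda>k::nat. sqrt (real (Suc k) * ln (ln (real (Suc k)))) \<le> sqrt (2 * real k * ln (ln (real k)))) sequentially"
    "eventually (\<lambda>k::nat. ln K \<le> sqrt (2 * real k * ln (ln (real k)))) sequentially"
    "eventually (\<lambda>k::nat. 0 < k) sequentially"
    by real_asymp+
  then show ?thesis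
  proof eventually_elim
    case (elim k)
    show ?case
    proof (intro allI impI, elim conjE)
      fix d assume d: "0 < d" "q * real k \<le> ln (1 / d)"
      define u where "u = \<beta> * ln (1 / d)"
      define G where "G v = sqrt (2 * v * ln (ln v))" for v
      have \<beta>q: "\<beta> * q = (C + 1)\<^sup>2" using q by (simp add: \<beta>)
      have \<beta>0: "0 < \<beta>" using q C by (simp add: \<beta>)
      have u: "(C + 1)\<^sup>2 * real k \<le> u"
        unfolding u_def \<beta>q[symmetric] mult.assoc using \<beta>0 d(2) by (intro mult_left_mono) auto
      have "1 * real k \<le> (C + 1)\<^sup>2 * real k" using C by (intro mult_right_mono) (auto intro: one_le_power)
      then have ku: "real k \<le> u" using u by simp
      then have lnk: "ln (real k) \<le> ln u" using elim(4) by simp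
      then have lnlnk: "0 \<le> ln (ln (real k))" "ln (ln (real k)) \<le> ln (ln u)" using elim(1) by auto
      have "(C + 1) * G (real k) = sqrt (2 * ((C + 1)\<^sup>2 * real k) * ln (ln (real k)))"
        using C by (simp add: G_def real_sqrt_mult)
      also have "\<dots> \<le> G u"
        unfolding G_def using u lnlnk ku by (intro real_sqrt_le_mono mult_mono) auto
      finally have Gu: "(C + 1) * G (real k) \<le> G u" .
      have "0 \<le> G u" using lnlnk ku by (simp add: G_def)
      have "ln K + C * sqrt (real (Suc k) * ln (ln (real (Suc k)))) \<le> G (real k) + C * G (real k)"
        using elim(2,3) C unfolding G_def by (intro add_mono mult_left_mono) auto
      also have "\<dots> = (C + 1) * G (real k)" by (simp add: algebra_simps)
      also have "\<dots> \<le> 1 * G u" using Gu by simp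
      also have "\<dots> \<le> (1 - (- \<epsilon>)) * G u"
        using \<open>0 \<le> G u\<close> \<epsilon> by (intro mult_right_mono) auto
      finally have "exp (ln K + C * sqrt (real (Suc k) * ln (ln (real (Suc k))))) \<le> exp ((1 - (- \<epsilon>)) * G u)"
        by simp
      then have "K * exp (C * sqrt (real (Suc k) * ln (ln (real (Suc k))))) \<le> exp ((1 - (- \<epsilon>)) * G u)"
        using K by (simp add: exp_add)
      then show "K * exp (C * sqrt (real (Suc k) * ln (ln (real (Suc k))))) * d powr s \<le> h1 s \<beta> (- \<epsilon>) d"
        unfolding h1_eq[OF d(1)] G_def u_def by (subst mult.commute) (intro mult_left_mono, auto)
    qed
  qed
qed

subsection \<open>Typical sequences\<close>

context homogeneous_rifs
begin

declare One_nat_def [simp del]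

definition log_number_mean :: real where
  "log_number_mean = expectation (\<lambda>l. ln (real (N l)))"

definition log_ratio_mean :: real where
  "log_ratio_mean = expectation (\<lambda>l. ln (c l 1))"

text \<open>The good event: all later statements about a single \<open>\<omega>\<close> are
  deterministic consequences of it. Having \<open>C\<close> as a parameter lets one constant serve
  almost every \<open>\<omega>\<close>, so the gauge can be fixed before
  \<open>\<omega>\<close>.\<close>

definition typical :: "real \<Rightarrow> (nat \<Rightarrow> real^'k) \<Rightarrow> bool" where
  "typical C \<omega> \<longleftrightarrow> range \<omega> \<subseteq> \<Lambda> \<and> eventually (\<lambda>n.
    \<bar>ln (real (number \<omega> n)) - real n * log_number_mean\<bar> \<le> C * sqrt (real n * ln (ln (real n))) \<and>
    \<bar>ln (radius \<omega> n) - real n * log_ratio_mean\<bar> \<le> C * sqrt (real n * ln (ln (real n)))) sequentially"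

lemma space_index: "space \<mu> = \<Lambda>"
  using sets_eq_imp_space_eq[OF sets_index_measure] by (simp add: space_restrict_space)

lemma measurable_c1 [measurable]: "(\<lambda>l. c l 1) \<in> borel_measurable \<mu>"
proof -
  have "{l \<in> \<Lambda>. 1 \<le> N l} = space \<mu>" using N_ge_1 by (auto simp: space_index)
  then have "(\<lambda>l. c l 1) \<in> borel_measurable (restrict_space \<mu> (space \<mu>))"
    using measurable_ratio[of 1] by simp
  moreover have "sets (restrict_space \<mu> (space \<mu>)) = sets \<mu>"
  proof -
    have "(\<inter>) (space \<mu>) ` sets \<mu> = id ` sets \<mu>"
      by (intro image_cong) (auto dest: sets.sets_into_space)
    then show ?thesis by (simp add: sets_restrict_space)
  qed
  ultimately show ?thesis by (simp cong: measurable_cong_sets)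
qed

lemma measurable_real_N [measurable]: "(\<lambda>l. real (N l)) \<in> borel_measurable \<mu>"
  using measurable_compose[OF measurable_N, of real borel] by simp

lemma ln_N_bounds: "l \<in> \<Lambda> \<Longrightarrow> \<bar>ln (real (N l))\<bar> \<le> ln (real N_max)"
  using N_ge_1[of l] N_le_max[of l] by simp

lemma ln_c1_bounds: "l \<in> \<Lambda> \<Longrightarrow> \<bar>ln (c l 1)\<bar> \<le> - ln c_min" "l \<in> \<Lambda> \<Longrightarrow> ln (c l 1) \<le> ln c_max"
  using ratio_bounds[of l] c1_bounds[of l] c_min_pos by (auto simp: abs_if)

lemma integrable_ln_N: "integrable \<mu> (\<lambda>l. ln (real (N l)))"
  by (rule integrable_const_bound[where B = "ln (real N_max)"]) (use ln_N_bounds in \<open>auto simp: space_index\<close>)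

lemma integrable_ln_c1: "integrable \<mu> (\<lambda>l. ln (c l 1))"
  by (rule integrable_const_bound[where B = "- ln c_min"]) (use ln_c1_bounds(1) in \<open>auto simp: space_index\<close>)

lemma log_ratio_mean_neg: "log_ratio_mean < 0"
proof -
  have "log_ratio_mean \<le> expectation (\<lambda>l. ln c_max)"
    unfolding log_ratio_mean_def using ln_c1_bounds(2) integrable_ln_c1 by (intro integral_mono) (auto simp: space_index)
  also have "\<dots> = ln c_max" by (simp add: prob_space)
  also have "\<dots> < 0" using c_max_pos c_max_less_1 by simp
  finally show ?thesis .
qed

lemma ln_number:
  assumes "range \<omega> \<subseteq> \<Lambda>"
  shows "ln (real (number \<omega> n)) = (\<Sum>i<n. ln (real (N (\<omega> i))))"
proof -
  have "N (\<omega> i) \<noteq> 0" for i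
    using N_ge_1[of "\<omega> i"] assms by (auto simp: image_subset_iff)
  then show ?thesis
    unfolding number_def of_nat_prod by (intro ln_prod) auto
qed

lemma ln_radius:
  assumes "range \<omega> \<subseteq> \<Lambda>"
  shows "ln (radius \<omega> n) = (\<Sum>i<n. ln (c (\<omega> i) 1))"
proof -
  have "c (\<omega> i) 1 \<noteq> 0" for i
    using c1_bounds(1)[of "\<omega> i"] assms by (auto simp: image_subset_iff)
  then show ?thesis
    unfolding radius_def by (intro ln_prod) auto
qed

lemma prob_space_P_H: "prob_space (P_H \<mu>)"
  unfolding P_H_def by (intro prob_space_PiM prob_space_axioms)

lemma AE_typical: "\<exists>C>0. AE \<omega> in P_H \<mu>. typical C \<omega>"
proof -
  let ?\<phi> = "\<lambda>n. sqrt (real n * ln (ln (real n)))"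
  obtain C1 where C1: "0 \<le> C1" "AE \<omega> in P_H \<mu>. eventually (\<lambda>n.
      \<bar>(\<Sum>i<n. ln (real (N (\<omega> i)))) - real n * log_number_mean\<bar> \<le> C1 * ?\<phi> n) sequentially"
    using AE_abs_sum_le_iterated_log[of "\<lambda>l. ln (real (N l))" "ln (real N_max)"] ln_N_bounds
    unfolding P_H_def log_number_mean_def by (auto simp: space_index)
  obtain C2 where C2: "0 \<le> C2" "AE \<omega> in P_H \<mu>. eventually (\<lambda>n.
      \<bar>(\<Sum>i<n. ln (c (\<omega> i) 1)) - real n * log_ratio_mean\<bar> \<le> C2 * ?\<phi> n) sequentially"
    using AE_abs_sum_le_iterated_log[of "\<lambda>l. ln (c l 1)" "- ln c_min"] ln_c1_bounds(1)
    unfolding P_H_def log_ratio_mean_def by (auto simp: space_index)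
  \<comment> \<open>A common constant for both sums; the 1 makes it strictly positive.\<close>
  define C where "C = C1 + C2 + 1"
  have C: "C1 \<le> C" "C2 \<le> C" "0 < C" using C1 C2 by (auto simp: C_def)
  have ev: "eventually (\<lambda>n::nat. 0 \<le> ?\<phi> n) sequentially" by real_asymp
  have "AE \<omega> in P_H \<mu>. typical C \<omega>"
    using C1(2) C2(2) AE_space
  proof eventually_elim
    case (elim \<omega>)
    have rng: "range \<omega> \<subseteq> \<Lambda>"
      using elim(3) by (auto simp: P_H_def space_PiM space_index)
    have "eventually (\<lambda>n.
      \<bar>(\<Sum>i<n. ln (real (N (\<omega> i)))) - real n * log_number_mean\<bar> \<le> C * ?\<phi> n \<and>
      \<bar>(\<Sum>i<n. ln (c (\<omega> i) 1)) - real n * log_ratio_mean\<bar> \<le> C * ?\<phi> n) sequentially"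
      using elim(1,2) ev
    proof eventually_elim
      case (elim n)
      show ?case
        using elim(1,2) mult_right_mono[OF C(1) elim(3)] mult_right_mono[OF C(2) elim(3)] by linarith
    qed
    then show ?case by (simp add: typical_def ln_number[OF rng] ln_radius[OF rng] rng)
  qed
  then show ?thesis using C(3) by blast
qed

lemma number_radius_powr:
  assumes "range \<omega> \<subseteq> \<Lambda>"
  shows "real (number \<omega> n) * radius \<omega> n powr t = exp (ln (real (number \<omega> n)) + t * ln (radius \<omega> n))"
  using number_pos[OF assms, of n] radius_pos[OF assms, of n] by (simp add: powr_def exp_add)

text \<open>The logarithm has positive linear drift, which dominates the fluctuation: one share
  \<open>C\<close> from \<open>number\<close> and a share \<open>t * C\<close> from
  \<open>radius\<close>.\<close>

lemma typical_number_tendsto: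
  assumes tp: "typical C \<omega>" and C: "0 < C" and t: "0 \<le> t"
    and pos: "0 < log_number_mean + t * log_ratio_mean"
  shows "filterlim (\<lambda>n. real (number \<omega> n) * radius \<omega> n powr t) at_top sequentially"
proof -
  have rng: "range \<omega> \<subseteq> \<Lambda>" using tp by (simp add: typical_def)
  define m where "m = log_number_mean + t * log_ratio_mean"
  define C' where "C' = (1 + t) * C"
  have "0 < m" "0 < C'" using pos C t by (auto simp: m_def C'_def)
  then have "filterlim (\<lambda>n. exp (real n * m - C' * sqrt (real n * ln (ln (real n))))) at_top sequentially"
    by real_asymp
  then show ?thesis
  proof (rule filterlim_at_top_mono)
    show "eventually (\<lambda>n. exp (real n * m - C' * sqrt (real n * ln (ln (real n)))) \<le> real (number \<omega> n) * radius \<omega> n powr t) sequentially"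
      using conjunct2[OF tp[unfolded typical_def]]
    proof eventually_elim
      case (elim n)
      have "t * (real n * log_ratio_mean - C * sqrt (real n * ln (ln (real n)))) \<le> t * ln (radius \<omega> n)"
        using elim t by (intro mult_left_mono) auto
      then show ?case
        unfolding number_radius_powr[OF rng] using elim by (simp add: m_def C'_def algebra_simps abs_le_iff)
    qed
  qed
qed

lemma typical_number_tendsto_0:
  assumes tp: "typical C \<omega>" and C: "0 < C" and t: "0 \<le> t"
    and neg: "log_number_mean + t * log_ratio_mean < 0"
  shows "(\<lambda>n. real (number \<omega> n) * radius \<omega> n powr t) \<longlonglongrightarrow> 0"
proof -
  have rng: "range \<omega> \<subseteq> \<Lambda>" using tp by (simp add: typical_def)
  define m where "m = - (log_number_mean + t * log_ratio_mean)"
  define C' where "C' = (1 + t) * C"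
  have "0 < m" "0 < C'" using neg C t by (auto simp: m_def C'_def)
  then have lim: "(\<lambda>n. exp (C' * sqrt (real n * ln (ln (real n))) - real n * m)) \<longlonglongrightarrow> 0"
    by real_asymp
  show ?thesis
  proof (rule tendsto_sandwich[OF _ _ tendsto_const lim])
    show "eventually (\<lambda>n. real (number \<omega> n) * radius \<omega> n powr t \<le> exp (C' * sqrt (real n * ln (ln (real n))) - real n * m)) sequentially"
      using conjunct2[OF tp[unfolded typical_def]]
    proof eventually_elim
      case (elim n)
      have "t * ln (radius \<omega> n) \<le> t * (real n * log_ratio_mean + C * sqrt (real n * ln (ln (real n))))"
        using elim t by (intro mult_left_mono) auto
      then show ?case
        unfolding number_radius_powr[OF rng] using elim by (simp add: m_def C'_def algebra_simps abs_le_iff)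
    qed
  qed simp
qed

lemma typical_number_at_top:
  assumes "typical C \<omega>" "0 < C" "0 < log_number_mean"
  shows "filterlim (\<lambda>n. real (number \<omega> n)) at_top sequentially"
proof -
  have "range \<omega> \<subseteq> \<Lambda>" using assms(1) by (simp add: typical_def)
  then have "radius \<omega> n powr 0 = 1" for n
    using radius_pos[of \<omega> n] by simp
  then show ?thesis
    using typical_number_tendsto[of C \<omega> 0] assms by simp
qed

text \<open>The drift \<open>log_number_mean + t * log_ratio_mean\<close> changes sign at the stated
  value: beyond it the \<open>t\<close>-dimensional measure vanishes, below it the measure is
  infinite.\<close>

lemma typical_hausdorff_dim:
  assumes tp: "typical C \<omega>" and C: "0 < C" and pos: "0 < log_number_mean"
  shows "hausdorff_dim (attractor N f \<Delta> \<omega>) = log_number_mean / - log_ratio_mean"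
proof -
  have rng: "range \<omega> \<subseteq> \<Lambda>" using tp by (simp add: typical_def)
  define s0 where "s0 = log_number_mean / - log_ratio_mean"
  have s0: "0 < s0" using pos log_ratio_mean_neg by (simp add: s0_def divide_pos_neg)
  let ?T = "{t. 0 < t \<and> hausdorff_measure (\<lambda>x. x powr t) (attractor N f \<Delta> \<omega>) = 0}"
  have above: "t \<in> ?T" if "s0 < t" for t
  proof -
    have "log_number_mean + t * log_ratio_mean < 0"
      using that log_ratio_mean_neg by (simp add: s0_def field_simps)
    then show ?thesis
      using hausdorff_measure_attractor_zero[OF rng, of t] typical_number_tendsto_0[OF tp C, of t] that s0 by simp
  qed
  have below: "s0 \<le> t" if "t \<in> ?T" for t
  proof (rule ccontr)
    assume "\<not> s0 \<le> t"
    then have t: "0 < t" "t < s0" using that by auto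
    then have m: "0 < log_number_mean + t * log_ratio_mean"
      using log_ratio_mean_neg by (simp add: s0_def field_simps)
    have lim: "filterlim (\<lambda>n. real (number \<omega> n) * radius \<omega> n powr t) at_top sequentially"
      using typical_number_tendsto[OF tp C _ m] t by simp
    have "hausdorff_measure (\<lambda>x. x powr t) (attractor N f \<Delta> \<omega>) = \<infinity>"
    proof (rule hausdorff_measure_attractor_infinite[OF rng typical_number_at_top[OF tp C pos]])
      fix K :: real assume "0 < K"
      have "eventually (\<lambda>n. K \<le> real (number \<omega> n) * radius \<omega> n powr t) sequentially"
        using lim by (simp add: filterlim_at_top)
      then have "eventually (\<lambda>n. K \<le> real (number \<omega> (Suc n)) * radius \<omega> (Suc n) powr t) sequentially"
        by (subst eventually_sequentially_Suc)
      then show "eventually (\<lambda>k. \<forall>d. radius \<omega> (Suc k) \<le> d \<and> d < radius \<omega> k \<longrightarrow>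
        K / real (number \<omega> (Suc k)) \<le> d powr t) sequentially"
      proof eventually_elim
        case (elim k)
        have "K / real (number \<omega> (Suc k)) \<le> radius \<omega> (Suc k) powr t"
          using elim number_pos[OF rng, of "Suc k"] by (simp add: field_simps)
        also have "\<dots> \<le> d powr t" if "radius \<omega> (Suc k) \<le> d" for d
          using that t radius_pos[OF rng, of "Suc k"] by (intro powr_mono2) auto
        finally show ?case by blast
      qed
    qed
    then show False using that by simp
  qed
  have bdd: "bdd_below ?T" using below by (meson bdd_belowI)
  have "Inf ?T = s0"
  proof (rule antisym)
    show "s0 \<le> Inf ?T" using above[of "s0 + 1"] below by (intro cInf_greatest) auto
    \<comment> \<open>Only exponents strictly above \<open>s0\<close> are known to belong to the
      set, so the bound is approached from above.\<close>
    show "Inf ?T \<le> s0" by (rule dense_ge) (intro cInf_lower above bdd)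
  qed
  then show ?thesis by (simp add: hausdorff_dim_def s0_def)
qed

text \<open>At this \<open>s\<close> the drift vanishes, and \<open>number * radius powr s\<close>
  can fall only to \<open>exp (- (1 + s) * C * R)\<close> at time \<open>n\<close>, with
  \<open>R\<close> the iterated logarithm term. The gauge compensates for this; the denominator
  \<open>- ln c_max\<close> in \<open>\<beta>\<close> comes from
  \<open>radius \<omega> k \<le> c_max ^ k\<close>.\<close>

lemma typical_hausdorff_measure_h1:
  assumes tp: "typical C \<omega>" and C: "0 < C" and pos: "0 < log_number_mean"
    and s: "0 < s" "log_number_mean + s * log_ratio_mean = 0" and \<epsilon>: "0 \<le> \<epsilon>" and r: "0 < r"
    and \<beta>: "\<beta> = ((1 + s) * C + 1)\<^sup>2 / - ln c_max"
  shows "hausdorff_measure (gauge_extend (h1 s \<beta> (- \<epsilon>)) r) (attractor N f \<Delta> \<omega>) = \<infinity>"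
proof (rule hausdorff_measure_attractor_infinite[OF _ typical_number_at_top[OF tp C pos]])
  show rng: "range \<omega> \<subseteq> \<Lambda>" using tp by (simp add: typical_def)
  fix K :: real assume K: "0 < K"
  have q: "0 < - ln c_max" using c_max_pos c_max_less_1 by simp
  have C': "0 \<le> (1 + s) * C" using s C by simp
  have small: "eventually (\<lambda>k. radius \<omega> k < r) sequentially"
    using order_tendstoD(2)[OF radius_tendsto_0[OF rng] r] .
  have "eventually (\<lambda>n. \<bar>ln (real (number \<omega> (Suc n))) - real (Suc n) * log_number_mean\<bar> \<le> C * sqrt (real (Suc n) * ln (ln (real (Suc n)))) \<and>
    \<bar>ln (radius \<omega> (Suc n)) - real (Suc n) * log_ratio_mean\<bar> \<le> C * sqrt (real (Suc n) * ln (ln (real (Suc n))))) sequentially"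
    using tp unfolding typical_def by (subst eventually_sequentially_Suc) simp
  then show "eventually (\<lambda>k. \<forall>d. radius \<omega> (Suc k) \<le> d \<and> d < radius \<omega> k \<longrightarrow>
      K / real (number \<omega> (Suc k)) \<le> gauge_extend (h1 s \<beta> (- \<epsilon>)) r d) sequentially"
    using h1_eventually_ge[OF C' q \<epsilon> K \<beta>, of s] small
  proof eventually_elim
    case (elim k)
    show ?case
    proof (intro allI impI, elim conjE)
      fix d assume d: "radius \<omega> (Suc k) \<le> d" "d < radius \<omega> k"
      define n where "n = Suc k"
      define R where "R = sqrt (real n * ln (ln (real n)))"
      have d0: "0 < d" using d(1) radius_pos[OF rng, of "Suc k"] by simp
      have "ln d \<le> ln (c_max ^ k)"
        using d d0 radius_le_power[OF rng, of k] c_max_pos by (subst ln_le_cancel_iff) auto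
      then have "- ln c_max * real k \<le> ln (1 / d)"
        using d0 c_max_pos by (simp add: ln_div ln_realpow mult.commute)
      then have h: "K * exp ((1 + s) * C * R) * d powr s \<le> h1 s \<beta> (- \<epsilon>) d"
        using elim(2) d0 unfolding R_def n_def by blast
      have "s * (real n * log_ratio_mean - C * R) \<le> s * ln (radius \<omega> n)"
        using elim(1) s(1) unfolding n_def R_def by (intro mult_left_mono) auto
      moreover have "real n * log_number_mean - C * R \<le> ln (real (number \<omega> n))"
        using elim(1) unfolding n_def R_def by auto
      moreover have "real n * log_number_mean + s * (real n * log_ratio_mean) = 0"
        using arg_cong[OF s(2), of "\<lambda>x. real n * x"] by (simp add: algebra_simps)
      ultimately have "0 \<le> (ln (real (number \<omega> n)) + s * ln (radius \<omega> n)) + (1 + s) * C * R"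
        by (simp add: algebra_simps)
      then have "1 \<le> real (number \<omega> n) * radius \<omega> n powr s * exp ((1 + s) * C * R)"
        unfolding number_radius_powr[OF rng] by (simp flip: exp_add)
      then have "K / real (number \<omega> n) \<le> K * exp ((1 + s) * C * R) * radius \<omega> n powr s"
        using number_pos[OF rng, of n] K by (simp add: field_simps)
      also have "\<dots> \<le> K * exp ((1 + s) * C * R) * d powr s"
        using K s(1) d radius_pos[OF rng, of n] unfolding n_def by (intro mult_left_mono powr_mono2) auto
      also note h
      also have "h1 s \<beta> (- \<epsilon>) d = gauge_extend (h1 s \<beta> (- \<epsilon>)) r d"
        using d d0 elim(3) by (simp add: gauge_extend_def)
      finally show "K / real (number \<omega> (Suc k)) \<le> gauge_extend (h1 s \<beta> (- \<epsilon>)) r d"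
        by (simp add: n_def)
    qed
  qed
qed

section \<open>Variance of the logarithmic ratio sum\<close>

text \<open>With equal ratios the sum is \<open>N l * c l 1 powr s\<close>, so its logarithm is
  affine in \<open>s\<close>.\<close>

lemma ln_ratio_sum:
  assumes "l \<in> \<Lambda>"
  shows "ln (ratio_sum N c s l) = ln (real (N l)) + s * ln (c l 1)" "0 < ratio_sum N c s l"
proof -
  have eq: "ratio_sum N c s l = real (N l) * c l 1 powr s"
  proof -
    have "ratio_sum N c s l = (\<Sum>j=1..N l. c l 1 powr s)"
      unfolding ratio_sum_def by (intro sum.cong refl) (subst equal_ratios[OF assms], auto)
    then show ?thesis by simp
  qed
  show "ln (ratio_sum N c s l) = ln (real (N l)) + s * ln (c l 1)" "0 < ratio_sum N c s l"
    unfolding eq using N_ge_1[OF assms] c1_bounds(1)[OF assms] by (simp_all add: ln_mult ln_powr)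
qed

lemma expectation_P_H_component:
  fixes g :: "real^'k \<Rightarrow> real"
  assumes "g \<in> borel_measurable \<mu>"
  shows "prob_space.expectation (P_H \<mu>) (\<lambda>\<omega>. g (\<omega> 0)) = expectation g"
proof -
  have "distr (P_H \<mu>) \<mu> (\<lambda>\<omega>. \<omega> 0) = \<mu>"
    unfolding P_H_def by (rule distr_PiM_component) (auto intro: prob_space_axioms)
  then show ?thesis
    using integral_distr[of "\<lambda>\<omega>. \<omega> 0" "P_H \<mu>" \<mu> g] assms by (simp add: P_H_def)
qed

text \<open>The variable is centred, so its variance is the second moment. If that were 0, the ratio
  sum would be 1 almost everywhere for this very \<open>s\<close>.\<close>

lemma variance_ln_ratio_sum_pos:
  assumes mean: "log_number_mean + s * log_ratio_mean = 0" and "\<not> almost_deterministic \<mu> N c"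
  shows "0 < prob_space.variance (P_H \<mu>) (\<lambda>\<omega>. ln (ratio_sum N c s (\<omega> 0)))"
proof -
  define g where "g l = ln (real (N l)) + s * ln (c l 1)" for l
  have g [measurable]: "g \<in> borel_measurable \<mu>" unfolding g_def by measurable
  have eq: "ln (ratio_sum N c s l) = g l" if "l \<in> space \<mu>" for l
    using ln_ratio_sum(1)[of l s] that by (simp add: g_def space_index)
  have meas [measurable]: "(\<lambda>l. ln (ratio_sum N c s l)) \<in> borel_measurable \<mu>"
    using measurable_cong[of \<mu> "\<lambda>l. ln (ratio_sum N c s l)" g borel, OF eq] g by simp
  have "expectation (\<lambda>l. ln (ratio_sum N c s l)) = expectation g"
    by (rule Bochner_Integration.integral_cong) (auto simp: eq)
  also have "\<dots> = 0"
    unfolding g_def using mean integrable_ln_N integrable_ln_c1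
    by (simp add: log_number_mean_def log_ratio_mean_def)
  finally have "prob_space.variance (P_H \<mu>) (\<lambda>\<omega>. ln (ratio_sum N c s (\<omega> 0)))
    = prob_space.expectation (P_H \<mu>) (\<lambda>\<omega>. (ln (ratio_sum N c s (\<omega> 0)))\<^sup>2)"
    by (simp add: expectation_P_H_component[OF meas])
  also have "\<dots> = expectation (\<lambda>l. (ln (ratio_sum N c s l))\<^sup>2)"
    by (rule expectation_P_H_component) measurable
  also have "\<dots> = expectation (\<lambda>l. (g l)\<^sup>2)"
    by (rule Bochner_Integration.integral_cong) (auto simp: eq)
  finally have var: "prob_space.variance (P_H \<mu>) (\<lambda>\<omega>. ln (ratio_sum N c s (\<omega> 0))) = expectation (\<lambda>l. (g l)\<^sup>2)" .
  \<comment> \<open>Needed to draw a conclusion from a vanishing integral, since the integral of a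
    non-integrable function is 0 by convention.\<close>
  have int: "integrable \<mu> (\<lambda>l. (g l)\<^sup>2)"
  proof (rule integrable_const_bound[where B = "(ln (real N_max) + \<bar>s\<bar> * (- ln c_min))\<^sup>2"])
    show "AE l in \<mu>. norm ((g l)\<^sup>2) \<le> (ln (real N_max) + \<bar>s\<bar> * (- ln c_min))\<^sup>2"
    proof (rule AE_I2)
      fix l assume "l \<in> space \<mu>"
      then have l: "l \<in> \<Lambda>" by (simp add: space_index)
      have "\<bar>s * ln (c l 1)\<bar> \<le> \<bar>s\<bar> * (- ln c_min)"
        unfolding abs_mult using ln_c1_bounds(1)[OF l] by (intro mult_left_mono) auto
      then have "\<bar>g l\<bar> \<le> ln (real N_max) + \<bar>s\<bar> * (- ln c_min)"
        using ln_N_bounds[OF l] unfolding g_def by linarith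
      then have "\<bar>g l\<bar>\<^sup>2 \<le> (ln (real N_max) + \<bar>s\<bar> * (- ln c_min))\<^sup>2"
        by (intro power_mono) auto
      then show "norm ((g l)\<^sup>2) \<le> (ln (real N_max) + \<bar>s\<bar> * (- ln c_min))\<^sup>2" by simp
    qed
  qed measurable
  have "expectation (\<lambda>l. (g l)\<^sup>2) \<noteq> 0"
  proof
    assume "expectation (\<lambda>l. (g l)\<^sup>2) = 0"
    then have "AE l in \<mu>. (g l)\<^sup>2 = 0"
      using integral_nonneg_eq_0_iff_AE[OF int] by simp
    then have "AE l in \<mu>. ratio_sum N c s l = 1"
      using AE_space
    proof eventually_elim
      case (elim l)
      then show ?case using eq[of l] ln_ratio_sum(2)[of l s] by (simp add: space_index)
    qed
    then show False using assms(2) by (auto simp: almost_deterministic_def)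
  qed
  moreover have "0 \<le> expectation (\<lambda>l. (g l)\<^sup>2)" by simp
  ultimately show ?thesis unfolding var by linarith
qed

text \<open>The dimension formula identifies \<open>s\<close> as the zero of the drift. A suitable
  \<open>\<beta>\<close> is then known, and positivity of the variance lets
  \<open>\<eta>\<^sub>0\<close> be the quotient of \<open>\<beta>\<close> by it.\<close>

lemma hausdorff_measure_h1_infinite:
  assumes "0 < log_number_mean" "\<not> almost_deterministic \<mu> N c"
    and "AE \<omega> in P_H \<mu>. hausdorff_dim (attractor N f \<Delta> \<omega>) = s" and "0 \<le> \<epsilon>"
  shows "\<exists>\<eta>\<^sub>0>0.
    let \<beta>\<^sub>0 = \<eta>\<^sub>0 * prob_space.variance (P_H \<mu>) (\<lambda>\<omega>. ln (ratio_sum N c s (\<omega> 0)))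
    in (\<exists>r\<^sub>0. h1_gauge_on s \<beta>\<^sub>0 (- \<epsilon>) r\<^sub>0) \<and>
       (\<forall>r\<^sub>0. h1_gauge_on s \<beta>\<^sub>0 (- \<epsilon>) r\<^sub>0 \<longrightarrow>
          (AE \<omega> in P_H \<mu>.
             hausdorff_measure (gauge_extend (h1 s \<beta>\<^sub>0 (- \<epsilon>)) r\<^sub>0) (attractor N f \<Delta> \<omega>) = \<infinity>))"
proof -
  interpret P: prob_space "P_H \<mu>" by (rule prob_space_P_H)
  obtain C where C: "0 < C" "AE \<omega> in P_H \<mu>. typical C \<omega>" using AE_typical by auto
  have "AE \<omega> in P_H \<mu>. s = log_number_mean / - log_ratio_mean"
    using assms(3) C(2) by eventually_elim (simp add: typical_hausdorff_dim[OF _ C(1) assms(1)])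
  \<comment> \<open>The equation does not involve \<open>\<omega>\<close>, so holding almost surely
    under a probability measure means holding.\<close>
  then have s_eq: "s = log_number_mean / - log_ratio_mean" by simp
  have s: "0 < s" unfolding s_eq using assms(1) log_ratio_mean_neg by (simp add: divide_pos_neg)
  have mean: "log_number_mean + s * log_ratio_mean = 0"
    unfolding s_eq using log_ratio_mean_neg by simp
  define v where "v = prob_space.variance (P_H \<mu>) (\<lambda>\<omega>. ln (ratio_sum N c s (\<omega> 0)))"
  have v: "0 < v" unfolding v_def using mean assms(2) by (rule variance_ln_ratio_sum_pos)
  define \<beta> where "\<beta> = ((1 + s) * C + 1)\<^sup>2 / - ln c_max"
  have "0 < (1 + s) * C + 1" using s C by (simp add: add_pos_pos)
  then have \<beta>: "0 < \<beta>"
    unfolding \<beta>_def using c_max_pos c_max_less_1 by (intro divide_pos_pos) auto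
  have "AE \<omega> in P_H \<mu>. hausdorff_measure (gauge_extend (h1 s \<beta> (- \<epsilon>)) r) (attractor N f \<Delta> \<omega>) = \<infinity>"
    if "h1_gauge_on s \<beta> (- \<epsilon>) r" for r
  proof -
    have r: "0 < r" using that by (simp add: h1_gauge_on_def)
    show ?thesis
      using C(2)
      by eventually_elim (rule typical_hausdorff_measure_h1[OF _ C(1) assms(1) s mean assms(4) r \<beta>_def])
  qed
  moreover have "\<exists>r. h1_gauge_on s \<beta> (- \<epsilon>) r" by (rule h1_gauge_on_exists[OF s \<beta>])
  moreover have "\<beta> / v * v = \<beta>" "0 < \<beta> / v" using v \<beta> by auto
  ultimately show ?thesis
    unfolding v_def[symmetric] Let_def by (intro exI[of _ "\<beta> / v"]) simp
qed

end

section \<open>Reduction of the hypotheses to the equal-ratio setting\<close>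

theorem theorem3p7:
  fixes \<Lambda> :: "(real^'k) set"
    and \<mu> :: "(real^'k) measure"
    and N :: "real^'k \<Rightarrow> nat"
    and f :: "real^'k \<Rightarrow> nat \<Rightarrow> real^'d \<Rightarrow> real^'d"
    and c :: "real^'k \<Rightarrow> nat \<Rightarrow> real"
    and \<Delta> :: "(real^'d) set"
    and c_min c_max s \<epsilon> :: real
  assumes "rifs \<Lambda> \<mu> N f c \<Delta>"
    and "UOSC \<Lambda> N f"
    and "2 \<le> (SUP l\<in>\<Lambda>. enat (N l))"
    and "(SUP l\<in>\<Lambda>. enat (N l)) < \<infinity>"
    and "prob_space.expectation (P_H \<mu>) (\<lambda>\<omega>. ln (real (N (\<omega> 0)))) > 0"
    and "0 < c_min" and "c_min \<le> c_max" and "c_max < 1"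
    and "\<forall>l\<in>\<Lambda>. \<exists>cl\<in>{c_min..c_max}. \<forall>i\<in>{1..N l}. c l i = cl"
    and "\<not> almost_deterministic \<mu> N c"
    and "AE \<omega> in P_H \<mu>. hausdorff_dim (attractor N f \<Delta> \<omega>) = s"
    and "0 < \<epsilon>"
  shows "\<exists>\<eta>\<^sub>0>0.
    let \<beta>\<^sub>0 = \<eta>\<^sub>0 * prob_space.variance (P_H \<mu>) (\<lambda>\<omega>. ln (ratio_sum N c s (\<omega> 0)))
    in (\<exists>r\<^sub>0. h1_gauge_on s \<beta>\<^sub>0 (- \<epsilon>) r\<^sub>0) \<and>
       (\<forall>r\<^sub>0. h1_gauge_on s \<beta>\<^sub>0 (- \<epsilon>) r\<^sub>0 \<longrightarrow>
          (AE \<omega> in P_H \<mu>.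
             hausdorff_measure (gauge_extend (h1 s \<beta>\<^sub>0 (- \<epsilon>)) r\<^sub>0) (attractor N f \<Delta> \<omega>) = \<infinity>))"
proof -
  interpret rifs \<Lambda> \<mu> N f c \<Delta> by (rule assms(1))
  obtain V where V: "V \<noteq> {}" "open V"
    "\<And>l i. \<lbrakk>l \<in> \<Lambda>; i \<in> {1..N l}\<rbrakk> \<Longrightarrow> f l i ` V \<subseteq> V"
    "\<And>l i j. \<lbrakk>l \<in> \<Lambda>; i \<in> {1..N l}; j \<in> {1..N l}; i \<noteq> j\<rbrakk> \<Longrightarrow> f l i ` V \<inter> f l j ` V = {}"
    using assms(2) unfolding UOSC_def by metis
  obtain N_max where N_max: "(SUP l\<in>\<Lambda>. enat (N l)) = enat N_max"
    using assms(4) by (cases "SUP l\<in>\<Lambda>. enat (N l)") auto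
  have N_le: "N l \<le> N_max" if "l \<in> \<Lambda>" for l
    using SUP_upper[OF that, of "\<lambda>l. enat (N l)"] unfolding N_max by simp
  have one: "1 \<in> {1..N l}" if "l \<in> \<Lambda>" for l using N_ge_1[OF that] by simp
  interpret homogeneous_rifs \<Lambda> \<mu> N f c \<Delta> V c_min c_max N_max
  proof (unfold_locales, goal_cases)
    \<comment> \<open>The remaining goals 7 and 8 are \<open>equal_ratios\<close> and
      \<open>ratio_bounds\<close>; both evaluate the common ratio at index 1.\<close>
    case (7 l i)
    then show ?case using assms(9) one[OF 7(1)] by metis
  next
    case (8 l)
    then show ?case using assms(9) one[OF 8] by (metis atLeastAtMost_iff)
  qed (use V assms(6,8) N_le in auto)
  have "0 < log_number_mean"
    using assms(5) expectation_P_H_component[of "\<lambda>l. ln (real (N l))"] by (simp add: log_number_mean_def)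
  then show ?thesis
    by (rule hausdorff_measure_h1_infinite[OF _ assms(10,11)]) (use assms(12) in simp)
qed

end
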